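(* For any $a\in\mathbb{R}\setminus\mathbb{Z}$, the embeddings in the Colombeau algebra $\mathcal{G}(\mathbb{R})$ of the distributions $\nu_{+}^{a}$, $\nu_{-}^{-a-2}$ and $\delta$ on $\mathbb{R}$ satisfy $$\widetilde{\nu_{+}^{a}}\cdot\widetilde{\nu_{-}^{-a-2}}\;-\;\widetilde{\delta}\cdot\widetilde{\delta}\;\approx\;-\frac{a+1}{2}\,\delta'.$$ That is, the generalized function on the left-hand side admits the distribution on the right-hand side as associated distribution.
   Context: $\mathbb{N}=\{1,2,\dots\}$, $\mathbb{N}_0=\mathbb{N}\cup\{0\}$; $\mathcal{D}(\mathbb{R})$ is the space of smooth compactly supported test functions, $\mathcal{D}'(\mathbb{R})$ the space of distributions, $\delta$ the Dirac distribution at $0$, and $\delta'$ its distributional derivative. **Colombeau algebra.** For $q\in\mathbb{N}_0$ put $A_q(\mathbb{R})=\{\varphi\in\mathcal{D}(\mathbb{R}):\int_{\mathbb{R}}x^j\varphi(x)\,dx=\delta_{0j},\ j=0,1,\dots,q\}$, where $\delta_{0j}=1$ if $j=0$ and $0$ otherwise. For $\varphi\in A_q(\mathbb{R})$ and $\varepsilon>0$ put $\varphi_\varepsilon(x)=\varepsilon^{-1}\varphi(\varepsilon^{-1}x)$ and $\check\varphi(x)=\varphi(-x)$. Let $\mathcal{E}[\mathbb{R}]$ be the algebra (pointwise operations) of functions $f(\varphi,x):A_0(\mathbb{R})\times\mathbb{R}\to\mathbb{C}$ that are infinitely differentiable in $x$ for each fixed $\varphi$. Let $\mathcal{E}_M[\mathbb{R}]$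 be the subalgebra of those $f$ such that for each compact $K\subset\mathbb{R}$ and $p\in\mathbb{N}_0$ there is $q\in\mathbb{N}$ such that for each $\varphi\in A_q(\mathbb{R})$, $\sup_{x\in K}|\partial_x^p f(\varphi_\varepsilon,x)|=O(\varepsilon^{-q})$ as $\varepsilon\to0_+$. Let $\mathcal{I}[\mathbb{R}]$ be the ideal of $\mathcal{E}_M[\mathbb{R}]$ of those $f$ such that for each compact $K\subset\mathbb{R}$ and $p\in\mathbb{N}_0$ there is $q\in\mathbb{N}$ such that for every $r\ge q$ and $\varphi\in A_r(\mathbb{R})$, $\sup_{x\in K}|\partial_x^p f(\varphi_\varepsilon,x)|=O(\varepsilon^{r-q})$ as $\varepsilon\to0_+$. Then $\mathcal{G}(\mathbb{R})=\mathcal{E}_M[\mathbb{R}]/\mathcal{I}[\mathbb{R}]$. **Embedding.** A distribution $u\in\mathcal{D}'(\mathbb{R})$ is embedded in $\mathcal{G}(\mathbb{R})$ as the class $\widetilde{u}$ of the representative $\widetilde{u}(\varphi,x)=(u*\check\varphi)(x)$. Products of embedded distributions are taken in $\mathcal{G}(\mathbb{R})$. **Association.** A generalized function $f\in\mathcal{G}(\mathbb{R})$ admits $u\in\mathcal{D}'(\mathbb{R})$ as associated distribution, written $f\approx u$, if for some representative $f(\varphi,x)$ of $f$ and any $\psi\in\mathcal{D}(\mathbb{R})$ there is $q\in\mathbb{N}_0$ such that for any $\varphi\in A_q(\mathbb{R})$, $\lim_{\varepsilon\to0_+}\int_{\mathbb{R}}f(\varphi_\varepsilon,x)\psi(x)\,dx=\langle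 u,\psi\rangle$. (This does not depend on the representative.) **The distributions $\nu_\pm^a$.** For real $a>-1$, $\nu_+^a(x)=x^a/\Gamma(a+1)$ if $x>0$ and $0$ if $x<0$; $\nu_-^a(x)=(-x)^a/\Gamma(a+1)$ if $x<0$ and $0$ if $x>0$ (locally integrable functions). For arbitrary $a\in\mathbb{R}\setminus\{-1,-2,\dots\}$, $\nu_+^a=\partial_x^r\nu_+^{a+r}$ and $\nu_-^a=(-1)^r\partial_x^r\nu_-^{a+r}$, where $r\in\mathbb{N}_0$ is such that $a+r>-1$ and derivatives are in the distributional sense. *)

theory Defs
  imports "HOL-Analysis.Analysis" "HOL-Library.Landau_Symbols" "HOL-Algebra.QuotRing"
begin

section \<open>Test functions and distributions on the real line\<close>

text \<open>
  The library's higher derivatives \<open>(deriv ^^ n) f\<close> need a function from a field to itself; for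
  complex-valued functions of a real variable the vector derivative is iterated instead.
\<close>

definition nderiv :: "nat \<Rightarrow> (real \<Rightarrow> complex) \<Rightarrow> real \<Rightarrow> complex" where
  "nderiv n = (\<lambda>g x. vector_derivative g (at x)) ^^ n"

definition smooth :: "(real \<Rightarrow> complex) \<Rightarrow> bool" where
  "smooth f \<longleftrightarrow> (\<forall>n x. nderiv n f differentiable (at x))"

definition test_functions :: "(real \<Rightarrow> complex) set" where
  "test_functions = {\<psi>. smooth \<psi> \<and> compact (closure {x. \<psi> x \<noteq> 0})}"

text \<open>
  Distributions are functionals on all functions, of which only the values on test functions
  matter. Continuity on the LF-space of test functions is expressed by the usual seminorm
  estimates on each compact set.
\<close>

type_synonym functional = "(real \<Rightarrow> complex) \<Rightarrow> complex"

definition distributions :: "functional set" where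
  "distributions = {u.
     (\<forall>\<psi>\<in>test_functions. \<forall>\<eta>\<in>test_functions. u (\<lambda>x. \<psi> x + \<eta> x) = u \<psi> + u \<eta>) \<and>
     (\<forall>c. \<forall>\<psi>\<in>test_functions. u (\<lambda>x. c * \<psi> x) = c * u \<psi>) \<and>
     (\<forall>K. compact K \<longrightarrow> (\<exists>C N. \<forall>\<psi>\<in>test_functions. closure {x. \<psi> x \<noteq> 0} \<subseteq> K \<longrightarrow>
        norm (u \<psi>) \<le> C * (\<Sum>k\<le>N. SUP x. norm (nderiv k \<psi> x))))}"

definition dist_of_fun :: "(real \<Rightarrow> complex) \<Rightarrow> functional" where
  "dist_of_fun f = (\<lambda>\<psi>. LINT x|lborel. f x * \<psi> x)"

definition dist_deriv :: "functional \<Rightarrow> functional" where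
  "dist_deriv u = (\<lambda>\<psi>. - u (nderiv 1 \<psi>))"

definition dist_scale :: "complex \<Rightarrow> functional \<Rightarrow> functional" where
  "dist_scale c u = (\<lambda>\<psi>. c * u \<psi>)"

definition dirac :: functional where
  "dirac = (\<lambda>\<psi>. \<psi> 0)"

definition reflect :: "(real \<Rightarrow> complex) \<Rightarrow> real \<Rightarrow> complex" where
  "reflect \<phi> = (\<lambda>x. \<phi> (- x))"

definition convolve :: "functional \<Rightarrow> (real \<Rightarrow> complex) \<Rightarrow> real \<Rightarrow> complex" where
  "convolve u \<phi> = (\<lambda>x. u (\<lambda>y. \<phi> (x - y)))"

section \<open>The distributions \<open>\<nu>\<^sub>+\<^sup>a\<close> and \<open>\<nu>\<^sub>-\<^sup>a\<close>\<close>

text \<open>The functions below are meant for \<open>a > -1\<close>, where they are locally integrable.\<close>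

definition nu_plus_fun :: "real \<Rightarrow> real \<Rightarrow> complex" where
  "nu_plus_fun a x = (if x > 0 then of_real (x powr a / Gamma (a + 1)) else 0)"

definition nu_minus_fun :: "real \<Rightarrow> real \<Rightarrow> complex" where
  "nu_minus_fun a x = (if x < 0 then of_real ((- x) powr a / Gamma (a + 1)) else 0)"

text \<open>
  Any \<open>r\<close> with \<open>a + r > -1\<close> yields the same distribution; the least one is taken. In particular
  \<open>r = 0\<close> if \<open>a > -1\<close>.
\<close>

definition nu_shift :: "real \<Rightarrow> nat" where
  "nu_shift a = (LEAST r. a + real r > -1)"

definition nu_plus :: "real \<Rightarrow> functional" where
  "nu_plus a = (let r = nu_shift a in (dist_deriv ^^ r) (dist_of_fun (nu_plus_fun (a + real r))))"

definition nu_minus :: "real \<Rightarrow> functional" where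
  "nu_minus a = (let r = nu_shift a in
     dist_scale ((-1) ^ r) ((dist_deriv ^^ r) (dist_of_fun (nu_minus_fun (a + real r)))))"

section \<open>The Colombeau algebra\<close>

text \<open>The sets \<open>A\<^sub>q\<close> of test functions with integral 1 and vanishing moments up to order \<open>q\<close>.\<close>

definition test_moments :: "nat \<Rightarrow> (real \<Rightarrow> complex) set" where
  "test_moments q = {\<phi> \<in> test_functions.
     \<forall>j\<le>q. (LINT x|lborel. of_real (x ^ j) * \<phi> x) = (if j = 0 then 1 else 0)}"

definition rescale :: "real \<Rightarrow> (real \<Rightarrow> complex) \<Rightarrow> real \<Rightarrow> complex" where
  "rescale \<epsilon> \<phi> = (\<lambda>x. of_real (inverse \<epsilon>) * \<phi> (inverse \<epsilon> * x))"

type_synonym gen_rep = "(real \<Rightarrow> complex) \<Rightarrow> real \<Rightarrow> complex"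

text \<open>
  Representatives are defined on \<open>test_moments 0\<close> only, hence the extensional function space.
  In the two growth conditions \<open>K \<noteq> {}\<close> is required because the real supremum of the
  empty set is not meaningful.
\<close>

definition E_alg :: "gen_rep set" where
  "E_alg = test_moments 0 \<rightarrow>\<^sub>E {g. smooth g}"

definition moderate :: "gen_rep set" where
  "moderate = {f \<in> E_alg. \<forall>K p. compact K \<and> K \<noteq> {} \<longrightarrow> (\<exists>q\<ge>1. \<forall>\<phi>\<in>test_moments q.
     (\<lambda>\<epsilon>. SUP x\<in>K. norm (nderiv p (f (rescale \<epsilon> \<phi>)) x)) \<in> O[at_right 0](\<lambda>\<epsilon>. \<epsilon> powi (- int q)))}"

definition negligible_reps :: "gen_rep set" where
  "negligible_reps = {f \<in> moderate. \<forall>K p. compact K \<and> K \<noteq> {} \<longrightarrow> (\<exists>q\<ge>1. \<forall>r\<ge>q. \<forall>\<phi>\<in>test_moments r.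
     (\<lambda>\<epsilon>. SUP x\<in>K. norm (nderiv p (f (rescale \<epsilon> \<phi>)) x)) \<in> O[at_right 0](\<lambda>\<epsilon>. \<epsilon> ^ (r - q)))}"

definition EM :: "gen_rep ring" where
  "EM = \<lparr>carrier = moderate,
         mult = (\<lambda>f g. \<lambda>\<phi>\<in>test_moments 0. \<lambda>x. f \<phi> x * g \<phi> x),
         one = (\<lambda>\<phi>\<in>test_moments 0. \<lambda>x. 1),
         zero = (\<lambda>\<phi>\<in>test_moments 0. \<lambda>x. 0),
         add = (\<lambda>f g. \<lambda>\<phi>\<in>test_moments 0. \<lambda>x. f \<phi> x + g \<phi> x)\<rparr>"

definition Colombeau :: "gen_rep set ring" where
  "Colombeau = EM Quot negligible_reps"

definition colombeau_embed :: "functional \<Rightarrow> gen_rep set" where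
  "colombeau_embed u = negligible_reps +>\<^bsub>EM\<^esub> (\<lambda>\<phi>\<in>test_moments 0. convolve u (reflect \<phi>))"

text \<open>
  The elements of the quotient are cosets, so the members of \<open>F\<close> are its representatives.
\<close>

definition admits_assoc_dist :: "gen_rep set \<Rightarrow> functional \<Rightarrow> bool" (infix "\<approx>" 50) where
  "F \<approx> u \<longleftrightarrow> F \<in> carrier Colombeau \<and> u \<in> distributions \<and>
     (\<exists>f\<in>F. \<forall>\<psi>\<in>test_functions. \<exists>q. \<forall>\<phi>\<in>test_moments q.
        ((\<lambda>\<epsilon>. LINT x|lborel. f (rescale \<epsilon> \<phi>) x * \<psi> x) \<longlongrightarrow> u \<psi>) (at_right 0))"

end

theory Submission
  imports Defs
begin

text \<open>
  For \<open>c > -1\<close> let \<open>I\<^sup>c\<close> and \<open>J\<^sup>c\<close> (\<open>frac_left\<close> and \<open>frac_right\<close>) denote the fractional integrals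
  from the left and from the right with the kernel \<open>y\<^sup>c / \<Gamma>(c + 1)\<close>, \<open>y > 0\<close>. Let \<open>r\<close> and \<open>s\<close> be the
  numbers of derivatives in the definitions of \<open>\<nu>\<^sub>+\<close> with exponent \<open>a\<close> and of \<open>\<nu>\<^sub>-\<close> with exponent
  \<open>-a-2\<close>, and put \<open>\<alpha> = a + r\<close>, \<open>\<beta> = -a - 2 + s\<close>; then \<open>\<alpha> + \<beta> + 2 = r + s\<close>. Moving the
  derivatives onto \<open>\<phi>\<close>, the two embeddings become \<open>(-1)\<^sup>r (J\<^sup>\<alpha> D\<^sup>r \<phi>)(-x)\<close> and
  \<open>(I\<^sup>\<beta> D\<^sup>s \<phi>)(-x)\<close>, and the embedding of \<open>\<delta>\<close> is \<open>\<phi>(-x)\<close>. Hence the left-hand side is represented by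
  \<open>P(-x)\<close> with the profile \<open>P = (-1)\<^sup>r J\<^sup>\<alpha> D\<^sup>r \<phi> \<cdot> I\<^sup>\<beta> D\<^sup>s \<phi> - \<phi>\<^sup>2\<close> (\<open>product_profile\<close>).

  The profile has compact support, because \<open>I\<^sup>\<beta> D\<^sup>s \<phi>\<close> vanishes far to the left and
  \<open>J\<^sup>\<alpha> D\<^sup>r \<phi>\<close> far to the right. By homogeneity, replacing \<open>\<phi>\<close> by \<open>\<phi>\<^sub>\<epsilon>\<close> replaces \<open>P(t)\<close> by
  \<open>\<epsilon>\<^sup>-\<^sup>2 P(t/\<epsilon>)\<close>, so that the pairing with \<open>\<psi>\<close> is
  \<open>\<epsilon>\<^sup>-\<^sup>1 \<integral> P(t) \<psi>(-\<epsilon>t) dt = \<epsilon>\<^sup>-\<^sup>1 \<psi>(0) \<integral> P(t) dt - \<psi>'(0) \<integral> t P(t) dt + O(\<epsilon>)\<close>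
  (\<open>vanishing_integral_concentrates_to_dirac_deriv\<close>). It remains to see that \<open>\<integral> P(t) dt = 0\<close> and
  \<open>\<integral> t P(t) dt = -(a + 1)/2\<close>.

  Three rules for fractional integrals give both moments: \<open>I\<^sup>\<beta>\<close> and \<open>J\<^sup>\<beta>\<close> are adjoint to each other;
  \<open>J\<^sup>\<beta> J\<^sup>\<alpha> = J\<^sup>c\<close> for \<open>c = \<alpha> + \<beta> + 1\<close>, by Euler's Beta integral; and \<open>J\<^sup>0\<close> is the inverse of \<open>-D\<close>.
  They turn \<open>\<integral> I\<^sup>\<beta> D\<^sup>s \<phi> \<cdot> J\<^sup>\<alpha> D\<^sup>r \<phi>\<close> into the integral of \<open>D\<^sup>s \<phi> \<cdot> J\<^sup>m D\<^sup>r \<phi>\<close> with \<open>m = r + s - 1\<close>, which is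
  \<open>(-1)\<^sup>r \<integral> \<phi>\<^sup>2\<close>; so the integral of \<open>P\<close> vanishes. For the first moment, multiplication by \<open>t\<close>
  commutes with \<open>J\<^sup>\<alpha> D\<^sup>r\<close> up to the term \<open>-(a + 1) J\<^sup>c D\<^sup>r\<close>, \<open>c = \<alpha> + 1\<close> (\<open>times_x_frac_right_nderiv\<close>). The
  main part is \<open>\<integral> t \<phi>\<^sup>2\<close> and cancels as before; the correction contributes
  \<open>-(a + 1) \<integral> \<phi> \<cdot> J\<^sup>0 \<phi> = -(a + 1)/2 \<cdot> (\<integral> \<phi>)\<^sup>2\<close>, since \<open>I\<^sup>0\<close> and \<open>J\<^sup>0\<close> are adjoint
  and add up to integration over the line.

  That this computation with representatives is a statement about the Colombeau algebra rests on
  two facts: the moderate functions form a ring in which the negligible ones are an ideal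
  (\<open>EM_cring\<close>, \<open>negligible_ideal\<close>), and the three embedded distributions are moderate
  (\<open>translation_invariant_moderate\<close>).
\<close>

section \<open>Smooth functions and test functions\<close>

lemma nderiv_0 [simp]: "nderiv 0 f = f"
  by (simp add: nderiv_def)

lemma nderiv_Suc: "nderiv (Suc n) f x = vector_derivative (nderiv n f) (at x)"
  by (simp add: nderiv_def)

lemma nderiv_nderiv: "nderiv m (nderiv n f) = nderiv (m + n) f"
  by (simp add: nderiv_def funpow_add)

lemma has_vector_derivative_nderiv:
  assumes "smooth f"
  shows "(nderiv n f has_vector_derivative nderiv (Suc n) f x) (at x)"
  using assms by (simp add: smooth_def nderiv_Suc vector_derivative_works)

text \<open>
  This lemma and the next one give all closure properties of smooth functions below: exhibit a
  sequence of candidates for the higher derivatives, and check one differentiation step.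
\<close>

lemma nderiv_eqI:
  assumes "\<And>n x. (D n has_vector_derivative D (Suc n) x) (at x)"
  shows "nderiv n (D 0) = D n"
proof (induction n)
  case (Suc n)
  show ?case
    by (rule ext) (simp add: nderiv_Suc Suc vector_derivative_at[OF assms])
qed simp

lemma smoothI:
  assumes "\<And>n x. (D n has_vector_derivative D (Suc n) x) (at x)"
  shows "smooth (D 0)"
  unfolding smooth_def nderiv_eqI[of D, OF assms]
  using assms differentiableI_vector by blast

lemma smooth_nderiv:
  assumes "smooth f"
  shows "smooth (nderiv n f)"
  using assms by (simp add: smooth_def nderiv_nderiv)

lemma continuous_on_nderiv:
  assumes "smooth f"
  shows "continuous_on A (nderiv n f)"
  using has_vector_derivative_nderiv[OF assms]
  by (metis continuous_at_imp_continuous_on has_vector_derivative_continuous)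

lemma continuous_on_smooth: "smooth f \<Longrightarrow> continuous_on A f"
  using continuous_on_nderiv[of f A 0] by simp

lemma
  assumes "smooth f" "smooth g"
  shows smooth_add: "smooth (\<lambda>x. f x + g x)"
    and nderiv_add: "nderiv n (\<lambda>x. f x + g x) = (\<lambda>x. nderiv n f x + nderiv n g x)"
proof -
  have D: "((\<lambda>x. nderiv n f x + nderiv n g x) has_vector_derivative
      nderiv (Suc n) f x + nderiv (Suc n) g x) (at x)" for n x
    by (intro has_vector_derivative_add has_vector_derivative_nderiv assms)
  show "smooth (\<lambda>x. f x + g x)"
    using smoothI[of "\<lambda>n x. nderiv n f x + nderiv n g x", OF D] by simp
  show "nderiv n (\<lambda>x. f x + g x) = (\<lambda>x. nderiv n f x + nderiv n g x)"
    using nderiv_eqI[of "\<lambda>n x. nderiv n f x + nderiv n g x", OF D] by simp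
qed

lemma
  assumes "smooth f"
  shows smooth_cmult: "smooth (\<lambda>x. c * f x)"
    and nderiv_cmult: "nderiv n (\<lambda>x. c * f x) = (\<lambda>x. c * nderiv n f x)"
proof -
  have D: "((\<lambda>x. c * nderiv n f x) has_vector_derivative c * nderiv (Suc n) f x) (at x)" for n x
    by (intro has_vector_derivative_mult_right has_vector_derivative_nderiv assms)
  show "smooth (\<lambda>x. c * f x)"
    using smoothI[of "\<lambda>n x. c * nderiv n f x", OF D] by simp
  show "nderiv n (\<lambda>x. c * f x) = (\<lambda>x. c * nderiv n f x)"
    using nderiv_eqI[of "\<lambda>n x. c * nderiv n f x", OF D] by simp
qed

lemma
  shows smooth_const: "smooth (\<lambda>x. c)"
    and nderiv_const: "nderiv n (\<lambda>x. c) = (\<lambda>x. if n = 0 then c else 0)"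
proof -
  have D: "((\<lambda>x. if n = 0 then c else 0) has_vector_derivative
      (if Suc n = 0 then c else 0)) (at x)" for n :: nat and x :: real
    by simp
  show "smooth (\<lambda>x. c)"
    using smoothI[of "\<lambda>n x. if n = 0 then c else 0", OF D] by simp
  show "nderiv n (\<lambda>x. c) = (\<lambda>x. if n = 0 then c else 0)"
    using nderiv_eqI[of "\<lambda>n x. if n = 0 then c else 0", OF D] by simp
qed

lemma
  assumes "smooth f"
  shows smooth_affine: "smooth (\<lambda>x. f (c * x + d))"
    and nderiv_affine: "nderiv n (\<lambda>x. f (c * x + d)) = (\<lambda>x. of_real c ^ n * nderiv n f (c * x + d))"
proof -
  have D: "((\<lambda>x. of_real c ^ n * nderiv n f (c * x + d)) has_vector_derivative
      of_real c ^ Suc n * nderiv (Suc n) f (c * x + d)) (at x)" for n x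
  proof -
    have "((\<lambda>x. c * x + d) has_vector_derivative c) (at x)"
      by (auto intro!: derivative_eq_intros)
    from vector_diff_chain_at[OF this has_vector_derivative_nderiv[OF assms]]
    have "((\<lambda>x. nderiv n f (c * x + d)) has_vector_derivative
        c *\<^sub>R nderiv (Suc n) f (c * x + d)) (at x)"
      by (simp add: o_def)
    from has_vector_derivative_mult_right[OF this, of "of_real c ^ n"] show ?thesis
      by (simp add: scaleR_conv_of_real mult_ac)
  qed
  show "smooth (\<lambda>x. f (c * x + d))"
    using smoothI[of "\<lambda>n x. of_real c ^ n * nderiv n f (c * x + d)", OF D] by simp
  show "nderiv n (\<lambda>x. f (c * x + d)) = (\<lambda>x. of_real c ^ n * nderiv n f (c * x + d))"
    using nderiv_eqI[of "\<lambda>n x. of_real c ^ n * nderiv n f (c * x + d)", OF D] by simp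
qed

text \<open>
  Differentiating the Leibniz sum of order \<open>n\<close> yields two sums, which Pascal's identity merges into the
  sum of order \<open>n + 1\<close>.
\<close>

lemma
  assumes "smooth f" "smooth g"
  shows smooth_mult: "smooth (\<lambda>x. f x * g x)"
    and nderiv_mult: "nderiv n (\<lambda>x. f x * g x) =
      (\<lambda>x. \<Sum>k\<le>n. of_nat (n choose k) * nderiv k f x * nderiv (n - k) g x)"
proof -
  define D where "D = (\<lambda>n x. \<Sum>k\<le>n. of_nat (n choose k) * nderiv k f x * nderiv (n - k) g x)"
  have D: "(D n has_vector_derivative D (Suc n) x) (at x)" for n x
  proof -
    have "(D n has_vector_derivative (\<Sum>k\<le>n. of_nat (n choose k) *
        (nderiv k f x * nderiv (Suc (n - k)) g x + nderiv (Suc k) f x * nderiv (n - k) g x))) (at x)"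
      unfolding D_def mult.assoc
      by (intro has_vector_derivative_sum has_vector_derivative_mult_right
          has_vector_derivative_mult has_vector_derivative_nderiv assms)
    also have "(\<Sum>k\<le>n. of_nat (n choose k) *
        (nderiv k f x * nderiv (Suc (n - k)) g x + nderiv (Suc k) f x * nderiv (n - k) g x)) =
        (\<Sum>k\<le>n. of_nat (n choose k) * nderiv k f x * nderiv (Suc n - k) g x) +
        (\<Sum>k\<le>n. of_nat (n choose k) * nderiv (Suc k) f x * nderiv (n - k) g x)"
      unfolding sum.distrib[symmetric]
      by (intro sum.cong refl) (simp add: algebra_simps Suc_diff_le)
    also have "(\<Sum>k\<le>n. of_nat (n choose k) * nderiv k f x * nderiv (Suc n - k) g x) =
        (\<Sum>k\<le>Suc n. of_nat (n choose k) * nderiv k f x * nderiv (Suc n - k) g x)"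
      by simp
    also have "\<dots> = nderiv 0 f x * nderiv (Suc n) g x +
        (\<Sum>k\<le>n. of_nat (n choose Suc k) * nderiv (Suc k) f x * nderiv (n - k) g x)"
      by (subst sum.atMost_Suc_shift) simp
    also have "\<dots> + (\<Sum>k\<le>n. of_nat (n choose k) * nderiv (Suc k) f x * nderiv (n - k) g x) =
        nderiv 0 f x * nderiv (Suc n) g x +
        (\<Sum>k\<le>n. of_nat (Suc n choose Suc k) * nderiv (Suc k) f x * nderiv (n - k) g x)"
      unfolding add.assoc sum.distrib[symmetric]
      by (intro arg_cong2[of _ _ _ _ "(+)"] sum.cong refl) (simp add: algebra_simps)
    also have "\<dots> = D (Suc n) x"
      unfolding D_def by (subst sum.atMost_Suc_shift) simp
    finally show ?thesis .
  qed
  have D0: "D 0 = (\<lambda>x. f x * g x)"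
    by (simp add: D_def)
  show "smooth (\<lambda>x. f x * g x)"
    using smoothI[of D, OF D] by (simp add: D0)
  show "nderiv n (\<lambda>x. f x * g x) =
      (\<lambda>x. \<Sum>k\<le>n. of_nat (n choose k) * nderiv k f x * nderiv (n - k) g x)"
    using nderiv_eqI[of D, OF D] by (simp add: D0 D_def)
qed

lemma
  assumes "smooth f"
  shows smooth_times_x: "smooth (\<lambda>x. of_real x * f x)"
    and nderiv_times_x: "nderiv n (\<lambda>x. of_real x * f x) =
      (\<lambda>x. of_real x * nderiv n f x + of_nat n * nderiv (n - 1) f x)"
proof -
  have D: "((\<lambda>x. of_real x * nderiv n f x + of_nat n * nderiv (n - 1) f x) has_vector_derivative
      of_real x * nderiv (Suc n) f x + of_nat (Suc n) * nderiv (Suc n - 1) f x) (at x)" for n x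
  proof -
    have 1: "((\<lambda>x. of_real x * nderiv n f x) has_vector_derivative
        (of_real x * nderiv (Suc n) f x + of_real 1 * nderiv n f x)) (at x)"
      by (intro has_vector_derivative_mult has_vector_derivative_nderiv assms
          has_vector_derivative_of_real derivative_intros)
    have 2: "((\<lambda>x. of_nat n * nderiv (n - 1) f x) has_vector_derivative
        of_nat n * nderiv n f x) (at x)"
    proof (cases n)
      case (Suc m)
      show ?thesis
        unfolding Suc diff_Suc_1
        by (intro has_vector_derivative_mult_right has_vector_derivative_nderiv assms)
    qed simp
    show ?thesis
      using has_vector_derivative_add[OF 1 2] by (simp add: algebra_simps)
  qed
  show "smooth (\<lambda>x. of_real x * f x)"
    using smoothI[of "\<lambda>n x. of_real x * nderiv n f x + of_nat n * nderiv (n - 1) f x", OF D] by simp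
  show "nderiv n (\<lambda>x. of_real x * f x) =
      (\<lambda>x. of_real x * nderiv n f x + of_nat n * nderiv (n - 1) f x)"
    using nderiv_eqI[of "\<lambda>n x. of_real x * nderiv n f x + of_nat n * nderiv (n - 1) f x", OF D] by simp
qed

lemma compact_support_iff:
  fixes f :: "real \<Rightarrow> complex"
  shows "compact (closure {x. f x \<noteq> 0}) \<longleftrightarrow> (\<exists>R>0. \<forall>x. \<bar>x\<bar> > R \<longrightarrow> f x = 0)"
proof -
  have "compact (closure {x. f x \<noteq> 0}) \<longleftrightarrow> bounded {x. f x \<noteq> 0}"
    by (simp add: compact_closure)
  also have "\<dots> \<longleftrightarrow> (\<exists>R>0. \<forall>x. \<bar>x\<bar> > R \<longrightarrow> f x = 0)"
    by (force simp: bounded_pos not_le)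
  finally show ?thesis .
qed

lemma test_functions_iff:
  "\<psi> \<in> test_functions \<longleftrightarrow> smooth \<psi> \<and> (\<exists>R>0. \<forall>x. \<bar>x\<bar> > R \<longrightarrow> \<psi> x = 0)"
  unfolding test_functions_def compact_support_iff by simp

lemma test_functions_smooth: "\<psi> \<in> test_functions \<Longrightarrow> smooth \<psi>"
  by (simp add: test_functions_iff)

lemma nderiv_eq_0_outside:
  assumes "\<And>x. \<bar>x\<bar> > R \<Longrightarrow> f x = 0" "\<bar>x\<bar> > R"
  shows "nderiv n f x = 0"
  using assms(2)
proof (induction n arbitrary: x)
  case 0
  then show ?case by (simp add: assms(1))
next
  case (Suc n)
  have "((\<lambda>x. 0) has_vector_derivative 0) (at x)"
    by simp
  moreover have "open {x::real. \<bar>x\<bar> > R}"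
    by (intro open_Collect_less continuous_intros)
  ultimately have "(nderiv n f has_vector_derivative 0) (at x)"
    by (rule has_vector_derivative_transform_within_open) (use Suc in auto)
  then show ?case
    by (simp add: nderiv_Suc vector_derivative_at)
qed

lemma test_functions_nderiv:
  assumes "\<psi> \<in> test_functions"
  shows "nderiv n \<psi> \<in> test_functions"
  using assms nderiv_eq_0_outside[of _ \<psi> _ n] unfolding test_functions_iff
  by (metis smooth_nderiv)

lemma test_functions_affine:
  assumes "\<psi> \<in> test_functions" "c \<noteq> 0"
  shows "(\<lambda>x. \<psi> (c * x + d)) \<in> test_functions"
proof -
  obtain R where R: "R > 0" "\<And>x. \<bar>x\<bar> > R \<Longrightarrow> \<psi> x = 0"
    using assms by (auto simp: test_functions_iff)
  have "\<psi> (c * x + d) = 0" if "\<bar>x\<bar> > (R + \<bar>d\<bar>) / \<bar>c\<bar>" for x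
  proof (rule R)
    have "R + \<bar>d\<bar> < \<bar>c * x\<bar>"
      using that assms(2) by (simp add: field_simps abs_mult)
    then show "R < \<bar>c * x + d\<bar>" by linarith
  qed
  moreover have "(R + \<bar>d\<bar>) / \<bar>c\<bar> > 0"
    using R assms by (auto intro!: divide_pos_pos)
  ultimately show ?thesis
    unfolding test_functions_iff using smooth_affine[of \<psi> c d] assms(1) test_functions_smooth
    by metis
qed

lemma test_functions_cmult:
  assumes "\<psi> \<in> test_functions"
  shows "(\<lambda>x. c * \<psi> x) \<in> test_functions"
  using assms by (auto simp: test_functions_iff smooth_cmult)

lemma test_functions_times_x:
  assumes "\<psi> \<in> test_functions"
  shows "(\<lambda>x. of_real x * \<psi> x) \<in> test_functions"
  using assms by (auto simp: test_functions_iff smooth_times_x)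

lemma test_functions_bounded:
  assumes "\<psi> \<in> test_functions"
  obtains B where "B > 0" "\<And>x. norm (\<psi> x) \<le> B"
proof -
  obtain R where R: "R > 0" "\<And>x. \<bar>x\<bar> > R \<Longrightarrow> \<psi> x = 0"
    using assms by (auto simp: test_functions_iff)
  have "compact (\<psi> ` {-R..R})"
    using assms by (intro compact_continuous_image continuous_on_smooth test_functions_smooth) auto
  then obtain B where B: "B > 0" "\<And>x. x \<in> {-R..R} \<Longrightarrow> norm (\<psi> x) \<le> B"
    by (auto dest!: compact_imp_bounded simp: bounded_pos)
  have "norm (\<psi> x) \<le> B" for x
    using B R(2)[of x] by (cases "x \<in> {-R..R}") auto
  then show ?thesis using that B(1) by blast
qed

lemma nderiv_rescale:
  assumes "smooth \<phi>"
  shows "nderiv n (rescale \<epsilon> \<phi>) =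
      (\<lambda>x. of_real (inverse \<epsilon> ^ Suc n) * nderiv n \<phi> (inverse \<epsilon> * x))"
proof -
  have *: "smooth (\<lambda>x. \<phi> (inverse \<epsilon> * x))"
    using smooth_affine[OF assms, of "inverse \<epsilon>" 0] by simp
  show "nderiv n (rescale \<epsilon> \<phi>) =
      (\<lambda>x. of_real (inverse \<epsilon> ^ Suc n) * nderiv n \<phi> (inverse \<epsilon> * x))"
    unfolding rescale_def nderiv_cmult[OF *]
    using nderiv_affine[OF assms, of n "inverse \<epsilon>" 0] by (simp add: mult.assoc)
qed

lemma test_moments_mono: "q \<le> r \<Longrightarrow> test_moments r \<subseteq> test_moments q"
  by (auto simp: test_moments_def)

lemma test_moments_test_functions: "\<phi> \<in> test_moments q \<Longrightarrow> \<phi> \<in> test_functions"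
  by (simp add: test_moments_def)

lemma rescale_test_moments:
  assumes "\<phi> \<in> test_moments q" "\<epsilon> > 0"
  shows "rescale \<epsilon> \<phi> \<in> test_moments q"
proof -
  have "rescale \<epsilon> \<phi> \<in> test_functions"
    unfolding rescale_def
    using test_functions_affine[of \<phi> "inverse \<epsilon>" 0] assms
    by (auto simp: test_moments_def intro!: test_functions_cmult)
  moreover have "(LINT x|lborel. of_real (x ^ j) * rescale \<epsilon> \<phi> x) =
      of_real (\<epsilon> ^ j) * (LINT x|lborel. of_real (x ^ j) * \<phi> x)" for j
  proof -
    have "(LINT x|lborel. of_real (x ^ j) * rescale \<epsilon> \<phi> x) =
        \<bar>\<epsilon>\<bar> *\<^sub>R (LINT x|lborel. of_real ((0 + \<epsilon> * x) ^ j) * rescale \<epsilon> \<phi> (0 + \<epsilon> * x))"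
      by (rule lborel_integral_real_affine) (use assms in simp)
    also have "(\<lambda>x. of_real ((0 + \<epsilon> * x) ^ j) * rescale \<epsilon> \<phi> (0 + \<epsilon> * x)) =
        (\<lambda>x. of_real (\<epsilon> ^ j * inverse \<epsilon>) * (of_real (x ^ j) * \<phi> x))"
      using assms(2) by (auto simp: rescale_def power_mult_distrib mult_ac field_simps)
    finally show ?thesis
      using assms(2) by (simp add: scaleR_conv_of_real del: of_real_mult of_real_power)
         (simp add: field_simps)
  qed
  ultimately show ?thesis
    using assms(1) by (auto simp: test_moments_def)
qed

section \<open>Fractional integrals\<close>

definition power_kernel :: "real \<Rightarrow> real \<Rightarrow> real" where
  "power_kernel a y = (if y > 0 then y powr a / Gamma (a + 1) else 0)"

text \<open>
  The order of these Weyl integrals is \<open>a + 1\<close>; indexing by the exponent of the kernel matches the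
  index of \<open>\<nu>\<close>. The values may lie in any Banach space so that the same operator can be applied
  to \<open>norm \<circ> K\<close>, which is how the hypotheses of Fubini's theorem are checked.
\<close>

definition frac_right :: "real \<Rightarrow> (real \<Rightarrow> 'b::{banach, second_countable_topology}) \<Rightarrow> real \<Rightarrow> 'b" where
  "frac_right a K t = (LINT y|lborel. power_kernel a y *\<^sub>R K (t + y))"

definition frac_left :: "real \<Rightarrow> (real \<Rightarrow> 'b::{banach, second_countable_topology}) \<Rightarrow> real \<Rightarrow> 'b" where
  "frac_left a K t = (LINT y|lborel. power_kernel a y *\<^sub>R K (t - y))"

text \<open>
  \<open>frac_right\<close> acts on functions that vanish far to the right, and it does not preserve compact
  support; the class \<open>right_supp\<close> is preserved. The dual class \<open>left_int\<close> only asks for local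
  integrability: it has to contain the translated kernels, because the semigroup law is
  obtained below by applying the adjointness of \<open>frac_left\<close> and \<open>frac_right\<close> to a kernel.
\<close>

definition right_supp :: "(real \<Rightarrow> 'b::real_normed_vector) \<Rightarrow> bool" where
  "right_supp K \<longleftrightarrow> continuous_on UNIV K \<and> (\<exists>R. \<forall>x>R. K x = 0)"

definition left_int :: "(real \<Rightarrow> 'b::{banach, second_countable_topology}) \<Rightarrow> bool" where
  "left_int \<Phi> \<longleftrightarrow> \<Phi> \<in> borel_measurable borel \<and> (\<exists>R. \<forall>x<R. \<Phi> x = 0) \<and>
     (\<forall>T. set_integrable lborel {..T} \<Phi>)"

lemma power_kernel_measurable [measurable]: "power_kernel a \<in> borel_measurable borel"
  unfolding power_kernel_def by measurable

lemma power_kernel_nonneg: "a > -1 \<Longrightarrow> power_kernel a y \<ge> 0"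
  by (simp add: power_kernel_def Gamma_real_nonneg)

lemma power_kernel_nonpos [simp]: "y \<le> 0 \<Longrightarrow> power_kernel a y = 0"
  by (simp add: power_kernel_def)

lemma power_kernel_0: "power_kernel 0 y = indicator {0<..} y"
  by (auto simp: power_kernel_def indicator_def)

lemma times_power_kernel:
  assumes "a > -1"
  shows "y * power_kernel a y = (a + 1) * power_kernel (a + 1) y"
proof (cases "y > 0")
  case True
  have "Gamma (a + 1 + 1) = (a + 1) * Gamma (a + 1)"
    using assms by (intro Gamma_plus1) (auto elim!: nonpos_Ints_cases)
  moreover have "y powr (a + 1) = y * y powr a"
    using True by (simp add: powr_add)
  ultimately show ?thesis
    using True assms by (simp add: power_kernel_def)
qed simp

lemma power_kernel_scale:
  assumes "c > 0"
  shows "power_kernel a (c * y) = c powr a * power_kernel a y"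
  using assms by (auto simp: power_kernel_def powr_mult zero_less_mult_iff)

text \<open>
  Transfers the closed forms of the power integral and of the Beta integral, which are stated for
  the gauge integral, to the Lebesgue integral.
\<close>

lemma has_bochner_integral_nonneg_has_integral:
  fixes f :: "real \<Rightarrow> real"
  assumes "f \<in> borel_measurable borel" "\<And>x. f x \<ge> 0" "(f has_integral I) UNIV"
  shows "has_bochner_integral lborel f I"
proof (rule has_bochner_integral_nn_integral)
  show "I \<ge> 0"
    using assms(2,3) by (rule has_integral_nonneg[rotated])
  show "(\<integral>\<^sup>+ x. ennreal (f x) \<partial>lborel) = ennreal I"
    by (rule nn_integral_has_integral_lborel[OF assms])
qed (use assms in auto)

lemma power_kernel_integrable:
  assumes "a > -1"
  shows "set_integrable lborel {..T} (power_kernel a)"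
proof -
  define S where "S = max 0 T"
  have "((\<lambda>x. if x \<in> {0..S} then x powr a else 0) has_integral (S powr (a+1) / (a+1))) UNIV"
    unfolding has_integral_restrict_UNIV
    by (rule has_integral_powr_from_0) (use assms S_def in auto)
  then have "has_bochner_integral lborel (\<lambda>x. if x \<in> {0..S} then x powr a else 0)
      (S powr (a+1) / (a+1))"
    by (rule has_bochner_integral_nonneg_has_integral[rotated -1]) auto
  then have "integrable lborel (\<lambda>x. (if x \<in> {0..S} then x powr a else 0) / Gamma (a + 1))"
    by (auto simp: has_bochner_integral_iff)
  also have "(\<lambda>x. (if x \<in> {0..S} then x powr a else 0) / Gamma (a + 1)) =
      (\<lambda>x. indicator {..S} x *\<^sub>R power_kernel a x)"
    by (auto simp: power_kernel_def indicator_def)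
  finally have "set_integrable lborel {..S} (power_kernel a)"
    by (simp add: set_integrable_def)
  then show ?thesis
    by (rule set_integrable_subset) (auto simp: S_def)
qed

text \<open>
  Substituting \<open>y = w u\<close> turns the convolution of two kernels into Euler's Beta integral.
\<close>

lemma power_kernel_convolution:
  assumes "a > -1" "b > -1"
  shows "(LINT y|lborel. power_kernel b y * power_kernel a (w - y)) = power_kernel (a + b + 1) w"
proof (cases "w > 0")
  case True
  define g where "g = (\<lambda>u::real. if u \<in> {0..1} then u powr b * (1 - u) powr a else 0)"
  have "(g has_integral Beta (b + 1) (a + 1)) UNIV"
    unfolding g_def has_integral_restrict_UNIV
    using has_integral_Beta_real[of "b + 1" "a + 1"] assms by simp
  then have g: "has_bochner_integral lborel g (Beta (b + 1) (a + 1))"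
    by (rule has_bochner_integral_nonneg_has_integral[rotated -1]) (auto simp: g_def)
  have "(LINT y|lborel. power_kernel b y * power_kernel a (w - y)) =
      \<bar>w\<bar> *\<^sub>R (LINT u|lborel. power_kernel b (0 + w * u) * power_kernel a (w - (0 + w * u)))"
    by (rule lborel_integral_real_affine) (use True in simp)
  also have "(\<lambda>u. power_kernel b (0 + w * u) * power_kernel a (w - (0 + w * u))) =
      (\<lambda>u. w powr (a + b) / (Gamma (a + 1) * Gamma (b + 1)) * g u)"
  proof
    fix u
    have "w - (0 + w * u) = w * (1 - u)"
      by (simp add: algebra_simps)
    then show "power_kernel b (0 + w * u) * power_kernel a (w - (0 + w * u)) =
        w powr (a + b) / (Gamma (a + 1) * Gamma (b + 1)) * g u"
      using power_kernel_scale[OF True, of b u] power_kernel_scale[OF True, of a "1 - u"] True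
      by (auto simp: power_kernel_def g_def powr_add mult_ac)
  qed
  also have "\<bar>w\<bar> *\<^sub>R integral\<^sup>L lborel \<dots> =
      w * (w powr (a + b) / (Gamma (a + 1) * Gamma (b + 1)) * Beta (b + 1) (a + 1))"
    using g True by (simp add: has_bochner_integral_iff)
  also have "\<dots> = power_kernel (a + b + 1) w"
  proof -
    have "Gamma (a + 1) > 0" "Gamma (b + 1) > 0"
      using assms by (auto intro!: Gamma_real_pos)
    moreover have "w * w powr (a + b) = w powr (a + b + 1)"
      using True by (simp add: powr_add)
    ultimately show ?thesis
      using True by (simp add: power_kernel_def Beta_def divide_simps) (simp add: add_ac)
  qed
  finally show ?thesis .
next
  case False
  then have "power_kernel b y * power_kernel a (w - y) = 0" for y
    by (cases "y > 0") auto
  then show ?thesis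
    using False by (simp only: Bochner_Integration.integral_zero power_kernel_nonpos not_less)
qed

lemma right_supp_continuous: "right_supp K \<Longrightarrow> continuous_on A K"
  unfolding right_supp_def using continuous_on_subset by blast

lemma right_supp_measurable:
  fixes K :: "real \<Rightarrow> 'b::{banach, second_countable_topology}"
  shows "right_supp K \<Longrightarrow> K \<in> borel_measurable borel"
  by (intro borel_measurable_continuous_onI right_supp_continuous)

lemma right_supp_norm: "right_supp K \<Longrightarrow> right_supp (\<lambda>x. norm (K x))"
  unfolding right_supp_def by (auto intro!: continuous_intros)

lemma right_supp_bounded:
  assumes "right_supp K"
  obtains B where "B > 0" "\<And>x. x \<ge> L \<Longrightarrow> norm (K x) \<le> B"
proof -
  obtain R where R: "\<And>x. x > R \<Longrightarrow> K x = 0"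
    using assms by (auto simp: right_supp_def)
  have "compact (K ` {L..R})"
    by (intro compact_continuous_image right_supp_continuous assms) auto
  then obtain B where B: "B > 0" "\<And>x. x \<in> {L..R} \<Longrightarrow> norm (K x) \<le> B"
    by (auto dest!: compact_imp_bounded simp: bounded_pos)
  have "norm (K x) \<le> B" if "x \<ge> L" for x
    using that B R[of x] by (cases "x \<le> R") auto
  then show ?thesis using that B(1) by blast
qed

text \<open>
  A function of one class times a function of the other lives on a bounded interval, where one
  factor is integrable and the other is bounded.
\<close>

lemma left_int_times_right_supp_norm:
  assumes "left_int \<Phi>" "right_supp K"
  shows "integrable lborel (\<lambda>x. norm (\<Phi> x) * norm (K x))"
proof -
  obtain L where L: "\<And>x. x < L \<Longrightarrow> \<Phi> x = 0"
    using assms by (auto simp: left_int_def)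
  obtain R where R: "\<And>x. x > R \<Longrightarrow> K x = 0"
    using assms by (auto simp: right_supp_def)
  obtain B where B: "B > 0" "\<And>x. x \<ge> L \<Longrightarrow> norm (K x) \<le> B"
    using right_supp_bounded[OF assms(2)] by blast
  have [measurable]: "\<Phi> \<in> borel_measurable borel"
    using assms(1) by (simp add: left_int_def)
  have [measurable]: "(\<lambda>x. norm (K x)) \<in> borel_measurable borel"
    using right_supp_measurable[OF right_supp_norm[OF assms(2)]] .
  have "set_integrable lborel {..R} \<Phi>"
    using assms by (simp add: left_int_def)
  then have "integrable lborel (\<lambda>x. B *\<^sub>R (indicator {..R} x *\<^sub>R \<Phi> x))"
    unfolding set_integrable_def by (intro integrable_scaleR_right)
  then show ?thesis
  proof (rule Bochner_Integration.integrable_bound)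
    have "norm (\<Phi> x) * norm (K x) \<le> B * (indicator {..R} x * norm (\<Phi> x))" for x
      using B(2)[of x] L[of x] R[of x]
      using mult_left_mono[OF B(2)[of x] norm_ge_zero[of "\<Phi> x"]]
      by (cases "x < L"; cases "x > R") (auto simp: mult.commute)
    then show "AE x in lborel. norm (norm (\<Phi> x) * norm (K x)) \<le>
        norm (B *\<^sub>R (indicator {..R} x *\<^sub>R \<Phi> x))"
      using B(1) by (intro AE_I2) (simp add: mult.assoc)
  qed measurable
qed

lemma left_int_times_right_supp:
  fixes \<Phi> K :: "real \<Rightarrow> complex"
  assumes "left_int \<Phi>" "right_supp K"
  shows "integrable lborel (\<lambda>x. \<Phi> x * K x)"
proof (rule Bochner_Integration.integrable_bound[OF left_int_times_right_supp_norm[OF assms]])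
  have [measurable]: "\<Phi> \<in> borel_measurable borel" "K \<in> borel_measurable borel"
    using assms by (auto simp: left_int_def right_supp_measurable)
  show "(\<lambda>x. \<Phi> x * K x) \<in> borel_measurable lborel" by measurable
qed (simp add: norm_mult)

lemma left_int_scaleR_right_supp:
  fixes \<Phi> :: "real \<Rightarrow> real" and K :: "real \<Rightarrow> 'b::{banach, second_countable_topology}"
  assumes "left_int \<Phi>" "right_supp K"
  shows "integrable lborel (\<lambda>x. \<Phi> x *\<^sub>R K x)"
proof (rule Bochner_Integration.integrable_bound[OF left_int_times_right_supp_norm[OF assms]])
  have [measurable]: "\<Phi> \<in> borel_measurable borel" "K \<in> borel_measurable borel"
    using assms by (auto simp: left_int_def right_supp_measurable)
  show "(\<lambda>x. \<Phi> x *\<^sub>R K x) \<in> borel_measurable lborel" by measurable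
qed simp

lemma left_int_continuous:
  assumes "continuous_on UNIV \<Phi>" "\<And>x. x < L \<Longrightarrow> \<Phi> x = 0"
  shows "left_int \<Phi>"
proof -
  have "set_integrable lborel {..T} \<Phi>" for T
  proof -
    have "set_integrable lborel {L..T} \<Phi>"
      by (rule borel_integrable_atLeastAtMost')
         (use assms(1) continuous_on_subset in blast)
    moreover have "(\<lambda>x. indicator {L..T} x *\<^sub>R \<Phi> x) = (\<lambda>x. indicator {..T} x *\<^sub>R \<Phi> x)"
      using assms(2) by (force simp: indicator_def)
    ultimately show ?thesis by (simp add: set_integrable_def)
  qed
  then show ?thesis
    using assms by (auto simp: left_int_def intro: borel_measurable_continuous_onI)
qed

lemma left_int_power_kernel_shift:
  assumes "a > -1"
  shows "left_int (\<lambda>w. power_kernel a (w - t))"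
proof -
  have "set_integrable lborel {..T} (\<lambda>w. power_kernel a (w - t))" for T
  proof -
    have "integrable lborel (\<lambda>x. indicator {..T - t} x *\<^sub>R power_kernel a x)"
      using power_kernel_integrable[OF assms] by (simp add: set_integrable_def)
    from lborel_integrable_real_affine[OF this, of 1 "- t"]
    have "integrable lborel (\<lambda>x. indicator {..T - t} (- t + 1 * x) *\<^sub>R power_kernel a (- t + 1 * x))"
      by simp
    also have "(\<lambda>x. indicator {..T - t} (- t + 1 * x) *\<^sub>R power_kernel a (- t + 1 * x)) =
        (\<lambda>x. indicator {..T} x *\<^sub>R power_kernel a (x - t))"
      by (auto simp: indicator_def)
    finally show ?thesis by (simp add: set_integrable_def)
  qed
  moreover have "power_kernel a (w - t) = 0" if "w < t" for w
    using that by simp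
  ultimately show ?thesis
    unfolding left_int_def by (auto intro!: exI[of _ t])
qed

lemma left_int_of_real:
  assumes "left_int \<Phi>"
  shows "left_int (\<lambda>x. complex_of_real (\<Phi> x))"
proof -
  have "set_integrable lborel {..T} (\<lambda>x. complex_of_real (\<Phi> x))" for T
  proof -
    have "integrable lborel (\<lambda>x. complex_of_real (indicator {..T} x *\<^sub>R \<Phi> x))"
      using assms by (intro integrable_of_real) (simp add: left_int_def set_integrable_def)
    then show ?thesis
      by (simp add: set_integrable_def scaleR_conv_of_real)
  qed
  then show ?thesis using assms by (auto simp: left_int_def)
qed

lemma frac_right_altdef:
  "frac_right a K t = (LINT w|lborel. power_kernel a (w - t) *\<^sub>R K w)"
proof -
  have "(LINT w|lborel. power_kernel a (w - t) *\<^sub>R K w) =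
      \<bar>1\<bar> *\<^sub>R (LINT y|lborel. power_kernel a (t + 1 * y - t) *\<^sub>R K (t + 1 * y))"
    by (rule lborel_integral_real_affine) simp
  also have "\<dots> = frac_right a K t"
    unfolding frac_right_def abs_one scaleR_one mult_1_left add_diff_cancel_left' ..
  finally show ?thesis ..
qed

lemma frac_left_altdef:
  "frac_left a \<Phi> t = (LINT z|lborel. power_kernel a (t - z) *\<^sub>R \<Phi> z)"
proof -
  have "(LINT z|lborel. power_kernel a (t - z) *\<^sub>R \<Phi> z) =
      \<bar>-1\<bar> *\<^sub>R (LINT y|lborel. power_kernel a (t - (t + (-1) * y)) *\<^sub>R \<Phi> (t + (-1) * y))"
    by (rule lborel_integral_real_affine) simp
  then show ?thesis by (simp add: frac_left_def)
qed

lemma frac_left_reflect: "frac_left a K t = frac_right a (\<lambda>x. K (- x)) (- t)"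
  by (simp add: frac_left_def frac_right_def)

lemma frac_integrable:
  fixes K :: "real \<Rightarrow> 'b::{banach, second_countable_topology}"
  assumes "a > -1" "right_supp K"
  shows "integrable lborel (\<lambda>w. power_kernel a (w - t) *\<^sub>R K w)"
    and "integrable lborel (\<lambda>y. power_kernel a y *\<^sub>R K (t + y))"
proof -
  show *: "integrable lborel (\<lambda>w. power_kernel a (w - t) *\<^sub>R K w)"
    by (rule left_int_scaleR_right_supp[OF left_int_power_kernel_shift]) (use assms in auto)
  show "integrable lborel (\<lambda>y. power_kernel a y *\<^sub>R K (t + y))"
    using lborel_integrable_real_affine[OF *, of 1 t] by simp
qed

text \<open>
  Only the part of the kernel up to \<open>R - t\<close> contributes, so the bound is uniform for \<open>t\<close> in a
  bounded set. This is the estimate behind moderateness.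
\<close>

lemma frac_right_norm_le:
  assumes "a > -1" "right_supp K" "\<And>x. x > R \<Longrightarrow> K x = 0" "\<And>x. x \<ge> t \<Longrightarrow> norm (K x) \<le> B"
    and "R - t \<le> T" "B \<ge> 0"
  shows "norm (frac_right a K t) \<le> B * (LINT y:{..T}|lborel. power_kernel a y)"
proof -
  have "norm (frac_right a K t) \<le> (LINT y|lborel. norm (power_kernel a y *\<^sub>R K (t + y)))"
    unfolding frac_right_def by (rule integral_norm_bound)
  also have "\<dots> \<le> (LINT y|lborel. B * (indicator {..T} y *\<^sub>R power_kernel a y))"
  proof (rule integral_mono)
    show "integrable lborel (\<lambda>y. norm (power_kernel a y *\<^sub>R K (t + y)))"
      by (intro integrable_norm frac_integrable assms)
    show "integrable lborel (\<lambda>y. B * (indicator {..T} y *\<^sub>R power_kernel a y))"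
      using power_kernel_integrable[OF assms(1), of T]
      by (intro integrable_mult_right) (simp add: set_integrable_def)
    fix y
    show "norm (power_kernel a y *\<^sub>R K (t + y)) \<le> B * (indicator {..T} y *\<^sub>R power_kernel a y)"
    proof (cases "y \<le> 0 \<or> y > T")
      case True
      then show ?thesis using assms(3)[of "t + y"] assms(5) by (auto simp: indicator_def)
    next
      case False
      then show ?thesis
        using mult_right_mono[OF assms(4)[of "t + y"] power_kernel_nonneg[OF assms(1), of y]]
          power_kernel_nonneg[OF assms(1), of y]
        by (simp add: mult.commute)
    qed
  qed
  finally show ?thesis by (simp add: set_lebesgue_integral_def)
qed

lemma right_supp_frac_right:
  assumes "a > -1" "right_supp K"
  shows "right_supp (frac_right a K)"
proof -
  obtain R where R: "\<And>x. x > R \<Longrightarrow> K x = 0"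
    using assms by (auto simp: right_supp_def)
  have "frac_right a K t = 0" if "t > R" for t
  proof -
    have "power_kernel a y *\<^sub>R K (t + y) = 0" for y
      using R[of "t + y"] that by (cases "y > 0") auto
    then show ?thesis unfolding frac_right_def by (simp only: Bochner_Integration.integral_zero)
  qed
  moreover have "continuous_on UNIV (frac_right a K)"
  proof (rule continuous_on_sequentiallyI)
    fix u :: "nat \<Rightarrow> real" and t
    assume u: "u \<longlonglongrightarrow> t"
    then obtain M where M: "\<And>n. \<bar>u n\<bar> \<le> M"
      using convergent_imp_Bseq[of u] by (auto simp: convergent_def Bseq_def)
    obtain B where B: "B > 0" "\<And>x. x \<ge> -M \<Longrightarrow> norm (K x) \<le> B"
      using right_supp_bounded[OF assms(2)] by blast
    have [measurable]: "K \<in> borel_measurable borel"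
      using assms(2) by (rule right_supp_measurable)
    show "(\<lambda>n. frac_right a K (u n)) \<longlonglongrightarrow> frac_right a K t"
      unfolding frac_right_def
    proof (rule integral_dominated_convergence)
      show "integrable lborel (\<lambda>y. B * (indicator {..R + M} y *\<^sub>R power_kernel a y))"
        using power_kernel_integrable[OF assms(1), of "R + M"]
        by (intro integrable_mult_right) (simp add: set_integrable_def)
      show "AE y in lborel. (\<lambda>n. power_kernel a y *\<^sub>R K (u n + y)) \<longlonglongrightarrow> power_kernel a y *\<^sub>R K (t + y)"
      proof (intro AE_I2 tendsto_intros)
        fix y
        have "isCont K (t + y)"
          using right_supp_continuous[OF assms(2), of UNIV]
          by (simp add: continuous_on_eq_continuous_at)
        then show "(\<lambda>n. K (u n + y)) \<longlonglongrightarrow> K (t + y)"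
          by (rule isCont_tendsto_compose) (intro tendsto_intros u)
      qed
      fix n
      show "AE y in lborel. norm (power_kernel a y *\<^sub>R K (u n + y)) \<le>
          B * (indicator {..R + M} y *\<^sub>R power_kernel a y)"
      proof (rule AE_I2)
        fix y
        show "norm (power_kernel a y *\<^sub>R K (u n + y)) \<le> B * (indicator {..R + M} y *\<^sub>R power_kernel a y)"
        proof (cases "y \<le> 0 \<or> y > R + M")
          case True
          then show ?thesis using R[of "u n + y"] M[of n] by (auto simp: indicator_def)
        next
          case False
          then show ?thesis
            using mult_right_mono[OF B(2)[of "u n + y"] power_kernel_nonneg[OF assms(1), of y]]
              abs_le_D2[OF M[of n]] power_kernel_nonneg[OF assms(1), of y]
            by (simp add: mult.commute)
        qed
      qed
    qed measurable
  qed
  ultimately show ?thesis unfolding right_supp_def by blast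
qed

text \<open>Both sides are the double integral of \<open>power_kernel b (x - z) * \<Phi> z * K x\<close>.\<close>

lemma frac_left_right_adjoint:
  fixes \<Phi> K :: "real \<Rightarrow> complex"
  assumes "b > -1" "left_int \<Phi>" "right_supp K"
  shows "(LINT x|lborel. frac_left b \<Phi> x * K x) = (LINT z|lborel. \<Phi> z * frac_right b K z)"
proof -
  have [measurable]: "\<Phi> \<in> borel_measurable borel" "K \<in> borel_measurable borel"
    using assms by (auto simp: left_int_def right_supp_measurable)
  define f where "f = (\<lambda>z x. power_kernel b (x - z) *\<^sub>R (\<Phi> z * K x))"
  have f: "f z x = \<Phi> z * (power_kernel b (x - z) *\<^sub>R K x)"
    "f z x = (power_kernel b (x - z) *\<^sub>R \<Phi> z) * K x" for z x
    by (simp_all add: f_def)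
  have "integrable (lborel \<Otimes>\<^sub>M lborel) (case_prod f)"
  proof (rule lborel_pair.Fubini_integrable)
    show "case_prod f \<in> borel_measurable (lborel \<Otimes>\<^sub>M lborel)"
      unfolding f_def by measurable
    show "AE z in lborel. integrable lborel (\<lambda>x. case (z, x) of (z, x) \<Rightarrow> f z x)"
      unfolding f(1) prod.case by (intro AE_I2 integrable_mult_right frac_integrable assms)
    have "(LINT x|lborel. norm (case (z, x) of (z, x) \<Rightarrow> f z x)) =
        norm (\<Phi> z) * norm (frac_right b (\<lambda>x. norm (K x)) z)" for z
    proof -
      have "(LINT x|lborel. norm (case (z, x) of (z, x) \<Rightarrow> f z x)) =
          (LINT x|lborel. norm (\<Phi> z) * (power_kernel b (x - z) *\<^sub>R norm (K x)))"
        using power_kernel_nonneg[OF assms(1)] by (simp add: f_def norm_mult mult_ac)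
      also have "\<dots> = norm (\<Phi> z) * frac_right b (\<lambda>x. norm (K x)) z"
        unfolding frac_right_altdef by simp
      also have "frac_right b (\<lambda>x. norm (K x)) z \<ge> 0"
        unfolding frac_right_def using power_kernel_nonneg[OF assms(1)]
        by (intro integral_nonneg_AE AE_I2) auto
      ultimately show ?thesis by simp
    qed
    then show "integrable lborel (\<lambda>z. LINT x|lborel. norm (case (z, x) of (z, x) \<Rightarrow> f z x))"
      using left_int_times_right_supp_norm[OF assms(2)
          right_supp_frac_right[OF assms(1) right_supp_norm[OF assms(3)]]]
      by simp
  qed
  then have "(LINT x|lborel. LINT z|lborel. f z x) = (LINT z|lborel. LINT x|lborel. f z x)"
    by (rule lborel_pair.Fubini_integral)
  moreover have "(LINT z|lborel. f z x) = frac_left b \<Phi> x * K x" for x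
    unfolding f(2) frac_left_altdef by (rule integral_mult_left_zero)
  moreover have "(LINT x|lborel. f z x) = \<Phi> z * frac_right b K z" for z
    unfolding f(1) frac_right_altdef by (rule integral_mult_right_zero)
  ultimately show ?thesis by simp
qed

text \<open>
  The semigroup law is adjointness applied to a translate of the kernel, whose image under
  \<open>frac_left b\<close> is a kernel again.
\<close>

lemma frac_right_frac_right:
  fixes K :: "real \<Rightarrow> complex"
  assumes "a > -1" "b > -1" "right_supp K"
  shows "frac_right a (frac_right b K) t = frac_right (a + b + 1) K t"
proof -
  define \<Phi> where "\<Phi> = (\<lambda>w. complex_of_real (power_kernel a (w - t)))"
  have \<Phi>: "left_int \<Phi>"
    unfolding \<Phi>_def by (intro left_int_of_real left_int_power_kernel_shift assms)
  have "frac_left b \<Phi> w = of_real (power_kernel (a + b + 1) (w - t))" for w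
  proof -
    have "frac_left b \<Phi> w =
        (LINT y|lborel. complex_of_real (power_kernel b y * power_kernel a ((w - t) - y)))"
      unfolding frac_left_def \<Phi>_def
      by (intro Bochner_Integration.integral_cong) (auto simp: scaleR_conv_of_real algebra_simps)
    also have "\<dots> = of_real (power_kernel (a + b + 1) (w - t))"
      unfolding integral_complex_of_real power_kernel_convolution[OF assms(1,2)] ..
    finally show ?thesis .
  qed
  then have "frac_right (a + b + 1) K t = (LINT w|lborel. frac_left b \<Phi> w * K w)"
    by (simp add: frac_right_altdef scaleR_conv_of_real)
  also have "\<dots> = (LINT w|lborel. \<Phi> w * frac_right b K w)"
    by (rule frac_left_right_adjoint[OF assms(2) \<Phi> assms(3)])
  also have "\<dots> = frac_right a (frac_right b K) t"
    by (simp add: frac_right_altdef \<Phi>_def scaleR_conv_of_real)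
  finally show ?thesis by simp
qed

lemma frac_right_0_has_derivative:
  fixes K :: "real \<Rightarrow> complex"
  assumes "right_supp K"
  shows "(frac_right 0 K has_vector_derivative - K x) (at x)"
proof -
  \<comment> \<open>any base point to the left of \<open>x\<close> will do\<close>
  define c where "c = x - 1"
  have int: "integrable lborel (\<lambda>w. indicator {t<..} w *\<^sub>R K w)" for t
    using frac_integrable(1)[of 0 K t] assms
    by (simp add: power_kernel_0 indicator_def)
  have J: "frac_right 0 K t = (LINT w|lborel. indicator {t<..} w *\<^sub>R K w)" for t
    unfolding frac_right_altdef power_kernel_0
    by (intro Bochner_Integration.integral_cong) (auto simp: indicator_def)
  have eq: "frac_right 0 K c - integral {c..t} K = frac_right 0 K t" if "t \<ge> c" for t
  proof -
    have "frac_right 0 K c - frac_right 0 K t =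
        (LINT w|lborel. indicator {c<..} w *\<^sub>R K w - indicator {t<..} w *\<^sub>R K w)"
      unfolding J by (intro Bochner_Integration.integral_diff[symmetric] int)
    also have "\<dots> = (LINT w:{c<..t}|lborel. K w)"
      unfolding set_lebesgue_integral_def using that
      by (intro Bochner_Integration.integral_cong) (auto simp: indicator_def)
    also have "\<dots> = (LINT w:{c..t}|lborel. K w)"
      by (rule set_integral_discrete_difference[where X = "{c}"]) (use that in auto)
    also have "\<dots> = integral {c..t} K"
      by (intro set_borel_integral_eq_integral borel_integrable_atLeastAtMost'
          right_supp_continuous assms)
    finally show ?thesis by (simp add: algebra_simps)
  qed
  have "((\<lambda>t. integral {c..t} K) has_vector_derivative K x) (at x within {c..x + 1})"
    by (rule integral_has_vector_derivative)
       (auto simp: c_def intro: right_supp_continuous assms)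
  then have "((\<lambda>t. integral {c..t} K) has_vector_derivative K x) (at x)"
    using at_within_Icc_at[of c x "x + 1"] by (simp add: c_def)
  then have "((\<lambda>t. frac_right 0 K c - integral {c..t} K) has_vector_derivative (0 - K x)) (at x)"
    by (intro has_vector_derivative_diff) auto
  then have "(frac_right 0 K has_vector_derivative (0 - K x)) (at x)"
  proof (rule has_vector_derivative_transform_within_open)
    show "x \<in> {c<..}" by (simp add: c_def)
    show "frac_right 0 K c - integral {c..t} K = frac_right 0 K t" if "t \<in> {c<..}" for t
      using that by (intro eq) simp
  qed auto
  then show ?thesis by simp
qed

text \<open>
  The two sides have the same derivative, and both vanish far to the right.
\<close>

lemma frac_right_0_deriv:
  fixes K :: "real \<Rightarrow> complex"
  assumes "right_supp K" "right_supp K'"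
    and "\<And>x. (K has_vector_derivative K' x) (at x)"
  shows "frac_right 0 K' t = - K t"
proof -
  have "((\<lambda>x. frac_right 0 K' x + K x) has_vector_derivative 0) (at x)" for x
    using has_vector_derivative_add[OF frac_right_0_has_derivative[OF assms(2)] assms(3), of x]
    by simp
  then obtain c where c: "\<And>x. frac_right 0 K' x + K x = c"
    using has_vector_derivative_zero_constant[of UNIV "\<lambda>x. frac_right 0 K' x + K x"] by auto
  obtain R where R: "\<And>x. x > R \<Longrightarrow> K x = 0"
    using assms(1) by (auto simp: right_supp_def)
  obtain S where S: "\<And>x. x > S \<Longrightarrow> frac_right 0 K' x = 0"
    using right_supp_frac_right[of 0 K'] assms(2) by (auto simp: right_supp_def)
  have "c = 0"
    using c[of "max R S + 1"] R[of "max R S + 1"] S[of "max R S + 1"] by simp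
  then show ?thesis
    using c[of t] by (simp add: eq_neg_iff_add_eq_0)
qed

lemma frac_right_uminus: "frac_right a (\<lambda>x. - K x) t = - frac_right a K t"
  by (simp add: frac_right_def)

text \<open>
  The semigroup law, with \<open>frac_right 0\<close> as the inverse of \<open>-D\<close>, replaces integration by parts
  against the kernel, which is singular at \<open>0\<close> for \<open>a < 0\<close>.
\<close>

lemma frac_right_Suc_deriv:
  fixes K :: "real \<Rightarrow> complex"
  assumes "a > -1" "right_supp K" "right_supp K'"
    and "\<And>x. (K has_vector_derivative K' x) (at x)"
  shows "frac_right (a + 1) K' t = - frac_right a K t"
proof -
  have "frac_right (a + 1) K' t = frac_right a (frac_right 0 K') t"
    using frac_right_frac_right[of a 0 K' t] assms by simp
  also have "frac_right 0 K' = (\<lambda>x. - K x)"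
    using frac_right_0_deriv[OF assms(2-4)] by blast
  finally show ?thesis by (simp add: frac_right_uminus)
qed

lemma frac_right_conv_frac_right_0:
  fixes K :: "real \<Rightarrow> complex"
  assumes "a > -1" "right_supp K" "right_supp K'"
    and "\<And>x. (K has_vector_derivative K' x) (at x)"
  shows "frac_right a K t = - frac_right 0 (frac_right a K') t"
  using frac_right_Suc_deriv[OF assms] frac_right_frac_right[of 0 a K' t] assms(1,3)
  by simp

text \<open>
  Writing \<open>frac_right a K\<close> as \<open>frac_right 0\<close> of a continuous function reduces differentiation
  under the integral sign to the fundamental theorem of calculus.
\<close>

lemma frac_right_has_derivative:
  fixes K :: "real \<Rightarrow> complex"
  assumes "a > -1" "right_supp K" "right_supp K'"
    and "\<And>x. (K has_vector_derivative K' x) (at x)"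
  shows "(frac_right a K has_vector_derivative frac_right a K' x) (at x)"
proof -
  have "frac_right a K = (\<lambda>t. - frac_right 0 (frac_right a K') t)"
    using frac_right_conv_frac_right_0[OF assms] by blast
  moreover have "((\<lambda>t. - frac_right 0 (frac_right a K') t) has_vector_derivative
      - (- frac_right a K' x)) (at x)"
    by (intro has_vector_derivative_minus frac_right_0_has_derivative right_supp_frac_right assms)
  ultimately show ?thesis by simp
qed

lemma right_supp_times_x:
  fixes K :: "real \<Rightarrow> complex"
  shows "right_supp K \<Longrightarrow> right_supp (\<lambda>x. of_real x * K x)"
  unfolding right_supp_def by (auto intro!: continuous_intros)

text \<open>
  The commutator comes from \<open>t = (t + y) - y\<close> under the integral; the factor \<open>y\<close> raises the exponent
  of the kernel by one.
\<close>

lemma times_x_frac_right: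
  fixes K :: "real \<Rightarrow> complex"
  assumes "a > -1" "right_supp K"
  shows "of_real t * frac_right a K t =
    frac_right a (\<lambda>x. of_real x * K x) t - of_real (a + 1) * frac_right (a + 1) K t"
proof -
  have "of_real t * (power_kernel a y *\<^sub>R K (t + y)) =
      power_kernel a y *\<^sub>R (of_real (t + y) * K (t + y)) -
      of_real (a + 1) * (power_kernel (a + 1) y *\<^sub>R K (t + y))" for y
  proof -
    have "of_real t * (power_kernel a y *\<^sub>R K (t + y)) =
        power_kernel a y *\<^sub>R (of_real (t + y) * K (t + y)) -
        of_real (y * power_kernel a y) * K (t + y)"
      by (simp add: scaleR_conv_of_real algebra_simps)
    then show ?thesis
      unfolding times_power_kernel[OF assms(1)] by (simp add: scaleR_conv_of_real)
  qed
  then have "of_real t * frac_right a K t = (LINT y|lborel.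
      power_kernel a y *\<^sub>R (of_real (t + y) * K (t + y)) -
      of_real (a + 1) * (power_kernel (a + 1) y *\<^sub>R K (t + y)))"
    unfolding frac_right_def integral_mult_right_zero[symmetric] by simp
  also have "\<dots> = frac_right a (\<lambda>x. of_real x * K x) t - of_real (a + 1) * frac_right (a + 1) K t"
    unfolding frac_right_def integral_mult_right_zero[symmetric] using assms
    by (intro Bochner_Integration.integral_diff integrable_mult_right frac_integrable(2)
        right_supp_times_x[of K]) auto
  finally show ?thesis .
qed

section \<open>Moments of products of fractional integrals of test functions\<close>

lemma test_functions_reflect: "\<psi> \<in> test_functions \<Longrightarrow> (\<lambda>x. \<psi> (- x)) \<in> test_functions"
  using test_functions_affine[of \<psi> "-1" 0] by simp

lemma test_functions_right_supp: "\<psi> \<in> test_functions \<Longrightarrow> right_supp \<psi>"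
  unfolding right_supp_def test_functions_iff
  by (metis abs_ge_self continuous_on_smooth less_le_trans)

lemma test_functions_left_int:
  assumes "\<psi> \<in> test_functions"
  shows "left_int \<psi>"
proof -
  obtain R where R: "R > 0" "\<And>x. \<bar>x\<bar> > R \<Longrightarrow> \<psi> x = 0"
    using assms by (auto simp: test_functions_iff)
  show ?thesis
  proof (rule left_int_continuous)
    show "\<psi> x = 0" if "x < - R" for x using R that by auto
  qed (intro continuous_on_smooth test_functions_smooth assms)
qed

lemma test_functions_has_derivative:
  assumes "\<psi> \<in> test_functions"
  shows "(nderiv n \<psi> has_vector_derivative nderiv (Suc n) \<psi> x) (at x)"
  by (intro has_vector_derivative_nderiv test_functions_smooth assms)

lemma frac_right_test_has_derivative:
  assumes "a > -1" "\<psi> \<in> test_functions"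
  shows "(frac_right a \<psi> has_vector_derivative frac_right a (nderiv 1 \<psi>) x) (at x)"
  using test_functions_has_derivative[OF assms(2), of 0]
  by (intro frac_right_has_derivative assms test_functions_right_supp test_functions_nderiv) simp

lemma nderiv_reflect:
  assumes "smooth f"
  shows "nderiv n (\<lambda>x. f (- x)) = (\<lambda>x. (-1) ^ n * nderiv n f (- x))"
  using nderiv_affine[OF assms, of n "-1" 0] by simp

lemma frac_left_test_has_derivative:
  assumes "a > -1" "\<psi> \<in> test_functions"
  shows "(frac_left a \<psi> has_vector_derivative frac_left a (nderiv 1 \<psi>) x) (at x)"
proof -
  have eq: "nderiv 1 (\<lambda>x. \<psi> (- x)) = (\<lambda>x. - nderiv 1 \<psi> (- x))"
    using nderiv_reflect[of \<psi> 1] assms by (simp add: test_functions_smooth)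
  have "(uminus has_vector_derivative -1) (at x)"
    by (auto intro!: derivative_eq_intros)
  from vector_diff_chain_at[OF this
      frac_right_test_has_derivative[OF assms(1) test_functions_reflect[OF assms(2)]]]
  show ?thesis
    unfolding o_def frac_left_reflect[abs_def] eq frac_right_uminus by simp
qed

lemma frac_right_test_Suc:
  assumes "a > -1" "\<psi> \<in> test_functions"
  shows "frac_right (a + 1) (nderiv (Suc n) \<psi>) t = - frac_right a (nderiv n \<psi>) t"
  by (intro frac_right_Suc_deriv assms test_functions_right_supp test_functions_nderiv
      test_functions_has_derivative)

lemma frac_right_0_test:
  assumes "\<psi> \<in> test_functions"
  shows "frac_right 0 (nderiv (Suc n) \<psi>) t = - nderiv n \<psi> t"
  by (intro frac_right_0_deriv assms test_functions_right_supp test_functions_nderiv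
      test_functions_has_derivative)

lemma frac_left_0_test:
  assumes "\<psi> \<in> test_functions"
  shows "frac_left 0 (nderiv 1 \<psi>) t = \<psi> t"
proof -
  have "(\<lambda>x. nderiv 1 \<psi> (- x)) = (\<lambda>x. - nderiv 1 (\<lambda>x. \<psi> (- x)) x)"
    using nderiv_reflect[of \<psi> 1] assms by (simp add: test_functions_smooth)
  then show ?thesis
    using frac_right_0_test[OF test_functions_reflect[OF assms], of 0 "- t"]
    by (simp add: frac_left_reflect frac_right_uminus)
qed

lemma frac_right_nat_nderiv:
  assumes "\<psi> \<in> test_functions"
  shows "frac_right (real m) (nderiv (Suc m) \<psi>) t = (-1) ^ Suc m * \<psi> t"
proof (induction m)
  case 0
  show ?case using frac_right_0_test[OF assms, of 0] by simp
next
  case (Suc m)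
  have "frac_right (real m + 1) (nderiv (Suc (Suc m)) \<psi>) t = - frac_right (real m) (nderiv (Suc m) \<psi>) t"
    by (rule frac_right_test_Suc) (use assms in auto)
  then show ?case using Suc by (simp add: add.commute)
qed

lemma frac_right_nat_nderiv_same:
  assumes "\<psi> \<in> test_functions"
  shows "frac_right (real m) (nderiv m \<psi>) t = (-1) ^ m * frac_right 0 \<psi> t"
proof (induction m)
  case (Suc m)
  have "frac_right (real m + 1) (nderiv (Suc m) \<psi>) t = - frac_right (real m) (nderiv m \<psi>) t"
    by (rule frac_right_test_Suc) (use assms in auto)
  then show ?case using Suc by (simp add: add.commute)
qed simp

text \<open>
  Integration by parts. The boundary terms are hidden in the identity
  \<open>frac_right a \<Psi> = - frac_right 0 (frac_right a (D \<Psi>))\<close>, since \<open>frac_right 0\<close> can be moved to the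
  other factor, where it undoes one derivative.
\<close>

lemma integral_nderiv_times_frac_right:
  assumes "a > -1" "\<Phi> \<in> test_functions" "\<Psi> \<in> test_functions"
  shows "(LINT x|lborel. nderiv s \<Phi> x * frac_right a \<Psi> x) =
    (-1) ^ s * (LINT x|lborel. \<Phi> x * frac_right a (nderiv s \<Psi>) x)"
  using assms(3)
proof (induction s arbitrary: \<Psi>)
  case (Suc s)
  define K where "K = frac_right a (nderiv 1 \<Psi>)"
  have K: "right_supp K"
    unfolding K_def using assms Suc.prems
    by (intro right_supp_frac_right test_functions_right_supp test_functions_nderiv)
  have *: "frac_right a \<Psi> x = - frac_right 0 K x" for x
    unfolding K_def using test_functions_has_derivative[OF Suc.prems, of 0] Suc.prems assms(1)
    by (intro frac_right_conv_frac_right_0 test_functions_right_supp test_functions_nderiv) auto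
  have "(LINT x|lborel. nderiv (Suc s) \<Phi> x * frac_right a \<Psi> x) =
      - (LINT x|lborel. nderiv (Suc s) \<Phi> x * frac_right 0 K x)"
    by (simp add: *)
  also have "(LINT x|lborel. nderiv (Suc s) \<Phi> x * frac_right 0 K x) =
      (LINT x|lborel. frac_left 0 (nderiv (Suc s) \<Phi>) x * K x)"
    using K assms by (intro frac_left_right_adjoint[symmetric] test_functions_left_int
        test_functions_nderiv) auto
  also have "frac_left 0 (nderiv (Suc s) \<Phi>) = nderiv s \<Phi>"
    using frac_left_0_test[OF test_functions_nderiv[OF assms(2), of s]]
    by (auto simp: nderiv_nderiv)
  also have "(LINT x|lborel. nderiv s \<Phi> x * K x) =
      (-1) ^ s * (LINT x|lborel. \<Phi> x * frac_right a (nderiv s (nderiv 1 \<Psi>)) x)"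
    unfolding K_def by (rule Suc.IH) (intro test_functions_nderiv Suc.prems)
  finally show ?case by (simp add: nderiv_nderiv)
qed simp

lemma integral_frac_left_times_frac_right:
  assumes "a > -1" "b > -1" "\<Phi> \<in> test_functions" "\<Psi> \<in> test_functions"
  shows "(LINT x|lborel. frac_left b (nderiv s \<Phi>) x * frac_right a (nderiv r \<Psi>) x) =
    (-1) ^ s * (LINT x|lborel. \<Phi> x * frac_right (a + b + 1) (nderiv (r + s) \<Psi>) x)"
proof -
  have "(LINT x|lborel. frac_left b (nderiv s \<Phi>) x * frac_right a (nderiv r \<Psi>) x) =
      (LINT x|lborel. nderiv s \<Phi> x * frac_right b (frac_right a (nderiv r \<Psi>)) x)"
    by (intro frac_left_right_adjoint right_supp_frac_right assms test_functions_left_int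
        test_functions_right_supp test_functions_nderiv)
  also have "\<dots> = (LINT x|lborel. nderiv s \<Phi> x * frac_right (a + b + 1) (nderiv r \<Psi>) x)"
    using frac_right_frac_right[OF assms(2,1) test_functions_right_supp[OF
        test_functions_nderiv[OF assms(4)]]] by (simp add: add.commute)
  also have "\<dots> = (-1) ^ s *
      (LINT x|lborel. \<Phi> x * frac_right (a + b + 1) (nderiv s (nderiv r \<Psi>)) x)"
    using assms by (intro integral_nderiv_times_frac_right test_functions_nderiv) auto
  finally show ?thesis by (simp add: nderiv_nderiv add.commute)
qed

text \<open>
  The exponents are such that the two fractional integrals compose to an ordinary iterated
  integral, of order \<open>r + s\<close>, which cancels all derivatives.
\<close>

lemma integral_frac_product_eq:
  assumes "a > -1" "b > -1" "a + b + 2 = real (r + s)"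
    and "\<Phi> \<in> test_functions" "\<Psi> \<in> test_functions"
  shows "(LINT x|lborel. frac_left b (nderiv s \<Phi>) x * frac_right a (nderiv r \<Psi>) x) =
    (-1) ^ r * (LINT x|lborel. \<Phi> x * \<Psi> x)"
proof -
  have "r + s \<noteq> 0"
    using assms(1-3) by linarith
  then obtain m where m: "r + s = Suc m"
    using not0_implies_Suc by blast
  have ab: "a + b + 1 = real m"
    using assms(3) m by simp
  have "(-1) ^ s * ((-1) ^ Suc m * z) = (-1) ^ r * z" for z :: complex
    unfolding m[symmetric] by (simp add: power_add mult_ac flip: power_mult_distrib)
  then show ?thesis
    unfolding integral_frac_left_times_frac_right[OF assms(1,2,4,5)] ab m
      frac_right_nat_nderiv[OF assms(5)] mult.left_commute[of _ "(-1) ^ Suc m"]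
      integral_mult_right_zero .
qed

text \<open>
  Here the exponents leave one ordinary integration in excess of the derivatives.
\<close>

lemma integral_frac_product_Suc:
  assumes "a > -1" "b > -1" "a + b + 1 = real (r + s)"
    and "\<Phi> \<in> test_functions" "\<Psi> \<in> test_functions"
  shows "(LINT x|lborel. frac_left b (nderiv s \<Phi>) x * frac_right a (nderiv r \<Psi>) x) =
    (-1) ^ r * (LINT x|lborel. \<Phi> x * frac_right 0 \<Psi> x)"
proof -
  have "(-1) ^ s * ((-1) ^ (r + s) * z) = (-1) ^ r * z" for z :: complex
    by (simp add: power_add mult_ac flip: power_mult_distrib)
  then show ?thesis
    unfolding integral_frac_left_times_frac_right[OF assms(1,2,4,5)] assms(3)
      frac_right_nat_nderiv_same[OF assms(5)] mult.left_commute[of _ "(-1) ^ (r + s)"]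
      integral_mult_right_zero .
qed

lemma integrable_test_function:
  assumes "\<psi> \<in> test_functions"
  shows "integrable lborel \<psi>"
proof -
  obtain R where R: "R > 0" "\<And>x. \<bar>x\<bar> > R \<Longrightarrow> \<psi> x = 0"
    using assms by (auto simp: test_functions_iff)
  have "(\<lambda>x. indicator {..R} x *\<^sub>R \<psi> x) = \<psi>"
    using R(2) by (force simp: indicator_def)
  then show ?thesis
    using test_functions_left_int[OF assms] by (auto simp: left_int_def set_integrable_def dest!: spec[of _ R])
qed

text \<open>
  The integrals of \<open>\<phi>\<close> to the left and to the right of a point add up to the total integral, and
  they are adjoint to each other.
\<close>

lemma integral_times_frac_right_0:
  assumes "\<phi> \<in> test_functions"
  shows "(LINT x|lborel. \<phi> x * frac_right 0 \<phi> x) = (LINT x|lborel. \<phi> x)\<^sup>2 / 2"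
proof -
  have sum: "frac_left 0 \<phi> x + frac_right 0 \<phi> x = (LINT x|lborel. \<phi> x)" for x
  proof -
    have int: "integrable lborel (\<lambda>z. power_kernel 0 (x - z) *\<^sub>R \<phi> z)"
      "integrable lborel (\<lambda>z. power_kernel 0 (z - x) *\<^sub>R \<phi> z)"
      by (rule Bochner_Integration.integrable_bound[OF integrable_test_function[OF assms]];
          use test_functions_right_supp[OF assms, THEN right_supp_measurable]
          in \<open>auto simp: power_kernel_0 indicator_def\<close>)+
    have "frac_left 0 \<phi> x + frac_right 0 \<phi> x =
        (LINT z|lborel. power_kernel 0 (x - z) *\<^sub>R \<phi> z + power_kernel 0 (z - x) *\<^sub>R \<phi> z)"
      unfolding frac_left_altdef frac_right_altdef
      by (intro Bochner_Integration.integral_add[symmetric] int)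
    also have "\<dots> = (LINT z|lborel. \<phi> z)"
    proof (rule integral_discrete_difference[where X = "{x}"])
      show "power_kernel 0 (x - z) *\<^sub>R \<phi> z + power_kernel 0 (z - x) *\<^sub>R \<phi> z = \<phi> z"
        if "z \<notin> {x}" for z
        using that by (auto simp: power_kernel_0 indicator_def)
    qed auto
    finally show ?thesis .
  qed
  have int: "integrable lborel (\<lambda>x. \<phi> x * frac_right 0 \<phi> x)"
    using assms by (intro left_int_times_right_supp test_functions_left_int right_supp_frac_right
        test_functions_right_supp) auto
  have "(LINT x|lborel. \<phi> x * frac_right 0 \<phi> x) = (LINT x|lborel. frac_left 0 \<phi> x * \<phi> x)"
    using assms by (intro frac_left_right_adjoint[symmetric] test_functions_left_int
        test_functions_right_supp) auto
  also have "\<dots> = (LINT x|lborel. (LINT y|lborel. \<phi> y) * \<phi> x - \<phi> x * frac_right 0 \<phi> x)"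
  proof (intro Bochner_Integration.integral_cong refl)
    show "frac_left 0 \<phi> x * \<phi> x = (LINT y|lborel. \<phi> y) * \<phi> x - \<phi> x * frac_right 0 \<phi> x" for x
      unfolding sum[of x, symmetric] by (simp add: algebra_simps)
  qed
  also have "\<dots> = (LINT x|lborel. \<phi> x)\<^sup>2 - (LINT x|lborel. \<phi> x * frac_right 0 \<phi> x)"
    using int integrable_test_function[OF assms] by (simp add: power2_eq_square)
  finally have "2 * (LINT x|lborel. \<phi> x * frac_right 0 \<phi> x) = (LINT x|lborel. \<phi> x)\<^sup>2"
    by (simp add: eq_diff_eq)
  then show ?thesis by (simp add: mult.commute)
qed

text \<open>
  Two commutators combine: that of \<open>x\<close> with \<open>frac_right a\<close>, with factor \<open>-(a + 1)\<close>, and that of \<open>x\<close>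
  with \<open>D\<^sup>r\<close>, with factor \<open>r\<close>. The sum \<open>-(a - r + 1)\<close> depends on \<open>a - r\<close> only, the exponent of the
  homogeneous distribution, and is the source of the factor \<open>a + 1\<close> in the theorem.
\<close>

lemma times_x_frac_right_nderiv:
  assumes "a > -1" "\<phi> \<in> test_functions"
  shows "of_real t * frac_right a (nderiv r \<phi>) t =
    frac_right a (nderiv r (\<lambda>x. of_real x * \<phi> x)) t -
    of_real (a - real r + 1) * frac_right (a + 1) (nderiv r \<phi>) t"
proof -
  define xD where "xD = nderiv r (\<lambda>x. of_real x * \<phi> x)"
  have xD: "right_supp xD"
    unfolding xD_def by (intro test_functions_right_supp test_functions_nderiv
        test_functions_times_x assms)
  have "(\<lambda>x. of_real x * nderiv r \<phi> x) = (\<lambda>x. xD x - of_nat r * nderiv (r - 1) \<phi> x)"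
    unfolding xD_def nderiv_times_x[OF test_functions_smooth[OF assms(2)]] by auto
  then have "frac_right a (\<lambda>x. of_real x * nderiv r \<phi> x) t =
      (LINT y|lborel. power_kernel a y *\<^sub>R xD (t + y) -
        of_nat r * (power_kernel a y *\<^sub>R nderiv (r - 1) \<phi> (t + y)))"
    unfolding frac_right_def fun_eq_iff
    by (intro Bochner_Integration.integral_cong refl) (simp only: scaleR_diff_right mult_scaleR_right)
  also have "\<dots> = frac_right a xD t - of_nat r * frac_right a (nderiv (r - 1) \<phi>) t"
    unfolding frac_right_def integral_mult_right_zero[symmetric]
    by (intro Bochner_Integration.integral_diff integrable_mult_right frac_integrable(2)[OF assms(1)]
        xD test_functions_right_supp[OF test_functions_nderiv[OF assms(2)]])
  also have "of_nat r * frac_right a (nderiv (r - 1) \<phi>) t =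
      - (of_nat r * frac_right (a + 1) (nderiv r \<phi>) t)"
    using frac_right_test_Suc[OF assms, of "r - 1" t] by (cases r) auto
  finally have "frac_right a (\<lambda>x. of_real x * nderiv r \<phi> x) t =
      frac_right a xD t + of_nat r * frac_right (a + 1) (nderiv r \<phi>) t"
    by simp
  moreover have "of_real t * frac_right a (nderiv r \<phi>) t =
      frac_right a (\<lambda>x. of_real x * nderiv r \<phi> x) t -
      of_real (a + 1) * frac_right (a + 1) (nderiv r \<phi>) t"
    by (intro times_x_frac_right assms test_functions_right_supp test_functions_nderiv)
  ultimately show ?thesis
    by (simp add: xD_def algebra_simps)
qed

text \<open>
  For the exponents \<open>a - r\<close> of \<open>\<nu>\<^sub>+\<close> and \<open>b - s\<close> of \<open>\<nu>\<^sub>-\<close>, this is the reflection at the origin of the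
  representative of the difference of the two products in the theorem.
\<close>

definition product_profile :: "nat \<Rightarrow> nat \<Rightarrow> real \<Rightarrow> real \<Rightarrow> (real \<Rightarrow> complex) \<Rightarrow> real \<Rightarrow> complex" where
  "product_profile r s a b \<phi> t =
     (-1) ^ r * frac_right a (nderiv r \<phi>) t * frac_left b (nderiv s \<phi>) t - \<phi> t * \<phi> t"

lemma left_int_frac_left:
  assumes "b > -1" "\<psi> \<in> test_functions"
  shows "left_int (frac_left b \<psi>)"
proof -
  have rs: "right_supp (frac_right b (\<lambda>x. \<psi> (- x)))"
    by (intro right_supp_frac_right assms test_functions_right_supp test_functions_reflect)
  then obtain R where R: "\<And>x. x > R \<Longrightarrow> frac_right b (\<lambda>x. \<psi> (- x)) x = 0"
    by (auto simp: right_supp_def)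
  show ?thesis
  proof (rule left_int_continuous)
    show "continuous_on UNIV (frac_left b \<psi>)"
      unfolding frac_left_reflect[abs_def]
      by (rule continuous_on_compose2[OF right_supp_continuous[OF rs, of UNIV]])
         (auto intro!: continuous_intros)
    show "frac_left b \<psi> x = 0" if "x < - R" for x
      using that by (simp add: frac_left_reflect R)
  qed
qed

context
  fixes r s :: nat and a b :: real
  assumes ab: "a > -1" "b > -1" "a + b + 2 = real (r + s)"
begin

lemma integrable_frac_product:
  assumes "\<phi> \<in> test_functions" "right_supp K"
  shows "integrable lborel (\<lambda>t. frac_left b (nderiv s \<phi>) t * K t)"
  by (intro left_int_times_right_supp left_int_frac_left test_functions_nderiv assms ab)

lemma integral_product_profile:
  assumes "\<phi> \<in> test_functions"
  shows "(LINT t|lborel. product_profile r s a b \<phi> t) = 0"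
proof -
  have 1: "right_supp (frac_right a (nderiv r \<phi>))"
    by (intro right_supp_frac_right ab test_functions_right_supp test_functions_nderiv assms)
  have 2: "integrable lborel (\<lambda>t. \<phi> t * \<phi> t)"
    by (intro left_int_times_right_supp test_functions_left_int test_functions_right_supp assms)
  have "(LINT t|lborel. product_profile r s a b \<phi> t) =
      (LINT t|lborel. (-1) ^ r * (frac_left b (nderiv s \<phi>) t * frac_right a (nderiv r \<phi>) t) - \<phi> t * \<phi> t)"
    unfolding product_profile_def
    by (intro Bochner_Integration.integral_cong) (auto simp: mult_ac)
  also have "\<dots> = (-1) ^ r * (LINT t|lborel. frac_left b (nderiv s \<phi>) t * frac_right a (nderiv r \<phi>) t)
      - (LINT t|lborel. \<phi> t * \<phi> t)"
    unfolding integral_mult_right_zero[symmetric]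
    by (intro Bochner_Integration.integral_diff integrable_mult_right integrable_frac_product assms 1 2)
  also have "\<dots> = 0"
    unfolding integral_frac_product_eq[OF ab assms assms]
    by (simp add: mult.assoc[symmetric] flip: power_mult_distrib)
  finally show ?thesis .
qed

lemma first_moment_product_profile:
  assumes "\<phi> \<in> test_functions"
  shows "(LINT t|lborel. of_real t * product_profile r s a b \<phi> t) =
    - of_real ((a - real r + 1) / 2) * (LINT t|lborel. \<phi> t)\<^sup>2"
proof -
  define x\<phi> where "x\<phi> = (\<lambda>x. of_real x * \<phi> x)"
  have x\<phi>: "x\<phi> \<in> test_functions"
    unfolding x\<phi>_def by (rule test_functions_times_x[OF assms])
  have 1: "right_supp (frac_right a (nderiv r x\<phi>))" "right_supp (frac_right (a + 1) (nderiv r \<phi>))"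
    using ab by (intro right_supp_frac_right test_functions_right_supp test_functions_nderiv assms x\<phi>; simp)+
  have 2: "integrable lborel (\<lambda>t. \<phi> t * x\<phi> t)"
    by (intro left_int_times_right_supp test_functions_left_int test_functions_right_supp assms x\<phi>)
  define c where "c = complex_of_real (a - real r + 1)"
  have "of_real t * product_profile r s a b \<phi> t =
      (-1) ^ r * (of_real t * frac_right a (nderiv r \<phi>) t) * frac_left b (nderiv s \<phi>) t - \<phi> t * x\<phi> t" for t
    by (simp add: product_profile_def x\<phi>_def algebra_simps)
  then have split: "of_real t * product_profile r s a b \<phi> t =
      (-1) ^ r * (frac_left b (nderiv s \<phi>) t * frac_right a (nderiv r x\<phi>) t) -
      (-1) ^ r * c * (frac_left b (nderiv s \<phi>) t * frac_right (a + 1) (nderiv r \<phi>) t) -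
      \<phi> t * x\<phi> t" for t
    unfolding times_x_frac_right_nderiv[OF ab(1) assms] x\<phi>_def c_def by (simp add: algebra_simps)
  define f where "f = (\<lambda>t. (-1) ^ r * (frac_left b (nderiv s \<phi>) t * frac_right a (nderiv r x\<phi>) t))"
  define g where "g = (\<lambda>t. (-1) ^ r * c * (frac_left b (nderiv s \<phi>) t * frac_right (a + 1) (nderiv r \<phi>) t))"
  have int: "integrable lborel f" "integrable lborel g"
    unfolding f_def g_def by (intro integrable_mult_right integrable_frac_product assms 1)+
  have sq: "(-1) ^ r * ((-1) ^ r * z) = z" for z :: complex
    by (simp flip: mult.assoc power_mult_distrib)
  have "(LINT t|lborel. of_real t * product_profile r s a b \<phi> t) =
      (LINT t|lborel. f t - g t - \<phi> t * x\<phi> t)"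
    unfolding f_def g_def by (intro Bochner_Integration.integral_cong refl split)
  also have "\<dots> = (LINT t|lborel. f t) - (LINT t|lborel. g t) - (LINT t|lborel. \<phi> t * x\<phi> t)"
    using int 2 by simp
  also have "(LINT t|lborel. f t) = (LINT t|lborel. \<phi> t * x\<phi> t)"
    unfolding f_def integral_mult_right_zero integral_frac_product_eq[OF ab assms x\<phi>] sq ..
  also have "(LINT t|lborel. g t) = c * ((-1) ^ r *
      (LINT t|lborel. frac_left b (nderiv s \<phi>) t * frac_right (a + 1) (nderiv r \<phi>) t))"
    unfolding g_def integral_mult_right_zero by (simp only: mult_ac)
  also have "(LINT t|lborel. frac_left b (nderiv s \<phi>) t * frac_right (a + 1) (nderiv r \<phi>) t) =
      (-1) ^ r * (LINT t|lborel. \<phi> t * frac_right 0 \<phi> t)"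
    by (rule integral_frac_product_Suc) (use ab assms in auto)
  also have "(LINT t|lborel. \<phi> t * frac_right 0 \<phi> t) = (LINT t|lborel. \<phi> t)\<^sup>2 / 2"
    by (rule integral_times_frac_right_0[OF assms])
  finally show ?thesis
    unfolding sq by (simp add: c_def)
qed

lemma product_profile_compact_support:
  assumes "\<phi> \<in> test_functions"
  shows "continuous_on UNIV (product_profile r s a b \<phi>)"
    and "\<exists>R>0. \<forall>t. \<bar>t\<bar> > R \<longrightarrow> product_profile r s a b \<phi> t = 0"
proof -
  have r: "right_supp (frac_right a (nderiv r \<phi>))"
    by (intro right_supp_frac_right ab test_functions_right_supp test_functions_nderiv assms)
  have l: "right_supp (frac_right b (\<lambda>x. nderiv s \<phi> (- x)))"
    by (intro right_supp_frac_right ab test_functions_right_supp test_functions_reflect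
        test_functions_nderiv assms)
  have "continuous_on UNIV (frac_left b (nderiv s \<phi>))"
    unfolding frac_left_reflect[abs_def]
    by (rule continuous_on_compose2[OF right_supp_continuous[OF l, of UNIV]])
       (auto intro!: continuous_intros)
  then show "continuous_on UNIV (product_profile r s a b \<phi>)"
    unfolding product_profile_def[abs_def]
    by (intro continuous_intros right_supp_continuous[OF r]
        continuous_on_smooth[OF test_functions_smooth[OF assms]])
  obtain R where R: "\<And>x. x > R \<Longrightarrow> frac_right a (nderiv r \<phi>) x = 0"
    using r by (auto simp: right_supp_def)
  obtain L where L: "\<And>x. x > L \<Longrightarrow> frac_right b (\<lambda>x. nderiv s \<phi> (- x)) x = 0"
    using l by (auto simp: right_supp_def)
  obtain S where S: "S > 0" "\<And>x. \<bar>x\<bar> > S \<Longrightarrow> \<phi> x = 0"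
    using assms by (auto simp: test_functions_iff)
  have "product_profile r s a b \<phi> t = 0" if "\<bar>t\<bar> > max S (max R L)" for t
    using that R[of t] L[of "- t"] S(2)[of t]
    by (cases "t > 0") (auto simp: product_profile_def frac_left_reflect)
  then show "\<exists>R>0. \<forall>t. \<bar>t\<bar> > R \<longrightarrow> product_profile r s a b \<phi> t = 0"
    using S(1) by (intro exI[of _ "max S (max R L)"]) auto
qed

end

lemma frac_right_rescale:
  assumes "\<epsilon> > 0" "smooth \<phi>"
  shows "frac_right a (nderiv n (rescale \<epsilon> \<phi>)) t =
    of_real (\<epsilon> powr (a - real n)) * frac_right a (nderiv n \<phi>) (inverse \<epsilon> * t)"
proof -
  have "frac_right a (nderiv n (rescale \<epsilon> \<phi>)) t =
      \<bar>\<epsilon>\<bar> *\<^sub>R (LINT y|lborel. power_kernel a (0 + \<epsilon> * y) *\<^sub>R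
        nderiv n (rescale \<epsilon> \<phi>) (t + (0 + \<epsilon> * y)))"
    unfolding frac_right_def by (rule lborel_integral_real_affine) (use assms in simp)
  also have "(\<lambda>y. power_kernel a (0 + \<epsilon> * y) *\<^sub>R nderiv n (rescale \<epsilon> \<phi>) (t + (0 + \<epsilon> * y))) =
      (\<lambda>y. of_real (\<epsilon> powr a * inverse \<epsilon> ^ Suc n) *
        (power_kernel a y *\<^sub>R nderiv n \<phi> (inverse \<epsilon> * t + y)))"
  proof
    fix y
    have "inverse \<epsilon> * (t + (0 + \<epsilon> * y)) = inverse \<epsilon> * t + y"
      using assms(1) by (simp add: field_simps)
    then show "power_kernel a (0 + \<epsilon> * y) *\<^sub>R nderiv n (rescale \<epsilon> \<phi>) (t + (0 + \<epsilon> * y)) =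
        of_real (\<epsilon> powr a * inverse \<epsilon> ^ Suc n) *
        (power_kernel a y *\<^sub>R nderiv n \<phi> (inverse \<epsilon> * t + y))"
      unfolding nderiv_rescale[OF assms(2)] using power_kernel_scale[OF assms(1), of a y]
      by (simp add: scaleR_conv_of_real mult_ac)
  qed
  also have "\<bar>\<epsilon>\<bar> *\<^sub>R (LINT y|lborel. of_real (\<epsilon> powr a * inverse \<epsilon> ^ Suc n) *
        (power_kernel a y *\<^sub>R nderiv n \<phi> (inverse \<epsilon> * t + y))) =
      of_real (\<epsilon> * (\<epsilon> powr a * inverse \<epsilon> ^ Suc n)) * frac_right a (nderiv n \<phi>) (inverse \<epsilon> * t)"
    unfolding integral_mult_right_zero frac_right_def using assms(1)
    by (simp add: scaleR_conv_of_real mult_ac)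
  also have "\<epsilon> * (\<epsilon> powr a * inverse \<epsilon> ^ Suc n) = \<epsilon> powr (a - real n)"
    using assms(1) by (simp add: powr_diff powr_realpow divide_inverse power_inverse)
  finally show ?thesis .
qed

lemma frac_left_rescale:
  assumes "\<epsilon> > 0" "smooth \<phi>"
  shows "frac_left a (nderiv n (rescale \<epsilon> \<phi>)) t =
    of_real (\<epsilon> powr (a - real n)) * frac_left a (nderiv n \<phi>) (inverse \<epsilon> * t)"
proof -
  define \<psi> where "\<psi> = (\<lambda>x. \<phi> (- x))"
  have \<psi>: "smooth \<psi>"
    unfolding \<psi>_def using smooth_affine[OF assms(2), of "-1" 0] by simp
  have 1: "(\<lambda>x. nderiv n \<phi> (- x)) = (\<lambda>x. (-1) ^ n * nderiv n \<psi> x)"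
    unfolding \<psi>_def nderiv_reflect[OF assms(2)]
    by (simp flip: power_mult_distrib mult.assoc)
  have 2: "(\<lambda>x. nderiv n (rescale \<epsilon> \<phi>) (- x)) = (\<lambda>x. (-1) ^ n * nderiv n (rescale \<epsilon> \<psi>) x)"
    using 1 by (simp add: nderiv_rescale assms \<psi> fun_eq_iff)
  have cm: "frac_right a (\<lambda>x. c * K x) t = c * frac_right a K t" for c :: complex and K t
    by (simp add: frac_right_def flip: integral_mult_right_zero)
  show ?thesis
    unfolding frac_left_reflect 1 2 cm frac_right_rescale[OF assms(1) \<psi>] by simp
qed

text \<open>
  The exponents \<open>a - r\<close> and \<open>b - s\<close> of homogeneity add up to \<open>-2\<close>, which is also the degree of \<open>\<delta>\<^sup>2\<close>.
\<close>

lemma product_profile_rescale: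
  assumes "\<epsilon> > 0" "smooth \<phi>" "a + b + 2 = real (r + s)"
  shows "product_profile r s a b (rescale \<epsilon> \<phi>) t =
    of_real ((inverse \<epsilon>)\<^sup>2) * product_profile r s a b \<phi> (inverse \<epsilon> * t)"
proof -
  have e: "\<epsilon> powr (a - real r) * \<epsilon> powr (b - real s) = (inverse \<epsilon>)\<^sup>2"
  proof -
    have "a - real r + (b - real s) = - 2"
      using assms(3) by simp
    then have "\<epsilon> powr (a - real r) * \<epsilon> powr (b - real s) = \<epsilon> powr (- 2)"
      by (simp flip: powr_add)
    also have "\<dots> = (inverse \<epsilon>)\<^sup>2"
      using assms(1) by (simp add: powr_minus powr_numeral power_inverse)
    finally show ?thesis .
  qed
  have "(-1) ^ r * (of_real (\<epsilon> powr (a - real r)) * A) * (of_real (\<epsilon> powr (b - real s)) * B) =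
      of_real (\<epsilon> powr (a - real r) * \<epsilon> powr (b - real s)) * ((-1) ^ r * A * B)" for A B :: complex
    unfolding of_real_mult by (simp only: mult_ac)
  then have *: "(-1) ^ r * (of_real (\<epsilon> powr (a - real r)) * A) * (of_real (\<epsilon> powr (b - real s)) * B) =
      of_real ((inverse \<epsilon>)\<^sup>2) * ((-1) ^ r * A * B)" for A B :: complex
    unfolding e .
  show ?thesis
    unfolding product_profile_def frac_right_rescale[OF assms(1,2)] frac_left_rescale[OF assms(1,2)] *
    by (simp add: rescale_def algebra_simps power2_eq_square)
qed

text \<open>
  The constant \<open>3 * B\<close> is crude: the linearization bound of the mean value theorem is applied first
  to \<open>\<psi>'\<close>, with increments of \<open>\<psi>''\<close> bounded by \<open>2 * B\<close>, and then to \<open>\<psi>\<close>.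
\<close>

lemma test_function_linearization:
  assumes "\<psi> \<in> test_functions"
  obtains C where "C \<ge> 0" "\<And>x. norm (\<psi> x - \<psi> 0 - of_real x * nderiv 1 \<psi> 0) \<le> C * x\<^sup>2"
proof -
  obtain B where B: "B > 0" "\<And>x. norm (nderiv 2 \<psi> x) \<le> B"
    using test_functions_bounded[OF test_functions_nderiv[OF assms]] by blast
  have lip: "norm (nderiv 1 \<psi> x - nderiv 1 \<psi> 0) \<le> 3 * B * \<bar>x\<bar>" for x
  proof -
    have "norm (nderiv 1 \<psi> x - nderiv 1 \<psi> 0 - (x - 0) *\<^sub>R nderiv 2 \<psi> 0) \<le> norm (x - 0) * (B + B)"
    proof (rule vector_differentiable_bound_linearization[where S = UNIV and f' = "nderiv 2 \<psi>"])
      show "(nderiv 1 \<psi> has_vector_derivative nderiv 2 \<psi> x) (at x)" for x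
        using test_functions_has_derivative[OF assms, of 1] by (simp add: numeral_2_eq_2)
      show "norm (nderiv 2 \<psi> x - nderiv 2 \<psi> 0) \<le> B + B" for x
        using norm_triangle_ineq4[of "nderiv 2 \<psi> x" "nderiv 2 \<psi> 0"] B(2)[of x] B(2)[of 0] by linarith
    qed auto
    moreover have "norm (x *\<^sub>R nderiv 2 \<psi> 0) \<le> \<bar>x\<bar> * B"
      using B(2)[of 0] by (simp add: mult_left_mono)
    ultimately show ?thesis
      using norm_triangle_sub[of "nderiv 1 \<psi> x - nderiv 1 \<psi> 0" "x *\<^sub>R nderiv 2 \<psi> 0"]
      by (simp add: algebra_simps)
  qed
  have "norm (\<psi> x - \<psi> 0 - of_real x * nderiv 1 \<psi> 0) \<le> (3 * B) * x\<^sup>2" for x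
  proof -
    have "norm (\<psi> x - \<psi> 0 - (x - 0) *\<^sub>R nderiv 1 \<psi> 0) \<le> norm (x - 0) * (3 * B * \<bar>x\<bar>)"
    proof (rule vector_differentiable_bound_linearization[where S = "closed_segment 0 x" and f' = "nderiv 1 \<psi>"])
      show "(\<psi> has_vector_derivative nderiv 1 \<psi> y) (at y within closed_segment 0 x)" for y
        using test_functions_has_derivative[OF assms, of 0]
        by (simp add: has_vector_derivative_at_within)
      show "norm (nderiv 1 \<psi> y - nderiv 1 \<psi> 0) \<le> 3 * B * \<bar>x\<bar>" if "y \<in> closed_segment 0 x" for y
      proof -
        have "\<bar>y\<bar> \<le> \<bar>x\<bar>"
          using that by (auto simp: closed_segment_eq_real_ivl split: if_splits)
        then show ?thesis
          using lip[of y] B(1) mult_left_mono[of "\<bar>y\<bar>" "\<bar>x\<bar>" "3 * B"] by linarith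
      qed
    qed auto
    also have "norm (x - 0) * (3 * B * \<bar>x\<bar>) = 3 * B * x\<^sup>2"
      by (simp add: power2_eq_square)
    finally show ?thesis
      by (simp add: scaleR_conv_of_real)
  qed
  then show ?thesis using that[of "3 * B"] B(1) by simp
qed

lemma integrable_compact_support:
  fixes f :: "real \<Rightarrow> 'b::{banach, second_countable_topology}"
  assumes "continuous_on UNIV f" "\<And>x. \<bar>x\<bar> > R \<Longrightarrow> f x = 0"
  shows "integrable lborel f"
proof -
  have "left_int f"
    by (rule left_int_continuous[where L = "- R"]) (use assms in auto)
  then have "integrable lborel (\<lambda>x. indicator {..R} x *\<^sub>R f x)"
    by (simp add: left_int_def set_integrable_def)
  also have "(\<lambda>x. indicator {..R} x *\<^sub>R f x) = f"
    using assms(2) by (force simp: indicator_def)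
  finally show ?thesis .
qed

text \<open>
  Substituting \<open>x = -\<epsilon>t\<close> and linearizing \<open>\<psi>\<close> at \<open>0\<close>: the constant term is killed by the vanishing
  integral of \<open>Q\<close>, the linear one gives the limit, and the remainder is of order \<open>\<epsilon>\<close>.
\<close>

lemma vanishing_integral_concentrates_to_dirac_deriv:
  assumes "continuous_on UNIV Q" "\<And>t. \<bar>t\<bar> > R \<Longrightarrow> Q t = 0" "(LINT t|lborel. Q t) = 0"
    and "\<psi> \<in> test_functions"
  shows "((\<lambda>\<epsilon>. LINT x|lborel. of_real ((inverse \<epsilon>)\<^sup>2) * Q (inverse \<epsilon> * (- x)) * \<psi> x) \<longlongrightarrow>
    - nderiv 1 \<psi> 0 * (LINT t|lborel. of_real t * Q t)) (at_right 0)"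
proof -
  obtain C where C: "C \<ge> 0" "\<And>x. norm (\<psi> x - \<psi> 0 - of_real x * nderiv 1 \<psi> 0) \<le> C * x\<^sup>2"
    using test_function_linearization[OF assms(4)] by blast
  define L where "L = - nderiv 1 \<psi> 0 * (LINT t|lborel. of_real t * Q t)"
  define M where "M = C * (LINT t|lborel. t\<^sup>2 * norm (Q t))"
  have bound: "norm ((LINT x|lborel. of_real ((inverse \<epsilon>)\<^sup>2) * Q (inverse \<epsilon> * (- x)) * \<psi> x) - L) \<le> \<epsilon> * M"
    if "\<epsilon> > 0" for \<epsilon>
  proof -
    \<comment> \<open>the remainder of the linearization, of size \<open>C * (\<epsilon> * t)\<^sup>2\<close>\<close>
    define \<rho> where "\<rho> = (\<lambda>t. \<psi> (- \<epsilon> * t) - \<psi> 0 - of_real (- \<epsilon> * t) * nderiv 1 \<psi> 0)"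
    have "continuous_on UNIV (\<lambda>t. \<psi> (- \<epsilon> * t))"
      by (rule continuous_on_compose2[OF continuous_on_smooth[OF test_functions_smooth[OF assms(4)], of UNIV]])
         (auto intro!: continuous_intros)
    then have "continuous_on UNIV \<rho>"
      unfolding \<rho>_def by (intro continuous_intros)
    then have int: "integrable lborel Q" "integrable lborel (\<lambda>t. of_real t * Q t)"
      "integrable lborel (\<lambda>t. Q t * \<rho> t)" "integrable lborel (\<lambda>t. t\<^sup>2 * norm (Q t))"
      using assms(1,2)
      by (auto intro!: integrable_compact_support[where R = R] continuous_intros)
    have "(LINT x|lborel. of_real ((inverse \<epsilon>)\<^sup>2) * Q (inverse \<epsilon> * (- x)) * \<psi> x) =
        \<bar>- \<epsilon>\<bar> *\<^sub>R (LINT t|lborel. of_real ((inverse \<epsilon>)\<^sup>2) *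
          Q (inverse \<epsilon> * (- (0 + (- \<epsilon>) * t))) * \<psi> (0 + (- \<epsilon>) * t))"
      by (rule lborel_integral_real_affine) (use that in simp)
    also have "(\<lambda>t. of_real ((inverse \<epsilon>)\<^sup>2) *
          Q (inverse \<epsilon> * (- (0 + (- \<epsilon>) * t))) * \<psi> (0 + (- \<epsilon>) * t)) =
        (\<lambda>t. of_real ((inverse \<epsilon>)\<^sup>2) * (\<psi> 0 * Q t + (of_real (- \<epsilon>) * nderiv 1 \<psi> 0) * (of_real t * Q t) + Q t * \<rho> t))"
    proof
      fix t
      have 1: "inverse \<epsilon> * (- (0 + (- \<epsilon>) * t)) = t" "0 + (- \<epsilon>) * t = - \<epsilon> * t"
        using that by auto
      show "of_real ((inverse \<epsilon>)\<^sup>2) * Q (inverse \<epsilon> * (- (0 + (- \<epsilon>) * t))) * \<psi> (0 + (- \<epsilon>) * t) =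
          of_real ((inverse \<epsilon>)\<^sup>2) * (\<psi> 0 * Q t + (of_real (- \<epsilon>) * nderiv 1 \<psi> 0) * (of_real t * Q t) + Q t * \<rho> t)"
        unfolding 1(1) unfolding 1(2) \<rho>_def by (simp add: algebra_simps)
    qed
    also have "(LINT t|lborel. of_real ((inverse \<epsilon>)\<^sup>2) * (\<psi> 0 * Q t + (of_real (- \<epsilon>) * nderiv 1 \<psi> 0) * (of_real t * Q t) + Q t * \<rho> t)) =
        of_real ((inverse \<epsilon>)\<^sup>2) * (of_real \<epsilon> * L + (LINT t|lborel. Q t * \<rho> t))"
      using int by (simp add: L_def assms(3))
    also have "\<bar>- \<epsilon>\<bar> *\<^sub>R \<dots> = L + of_real (inverse \<epsilon>) * (LINT t|lborel. Q t * \<rho> t)"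
      using that by (simp add: scaleR_conv_of_real field_simps power2_eq_square)
    finally have "norm ((LINT x|lborel. of_real ((inverse \<epsilon>)\<^sup>2) * Q (inverse \<epsilon> * (- x)) * \<psi> x) - L) =
        inverse \<epsilon> * norm (LINT t|lborel. Q t * \<rho> t)"
      using that by (simp add: norm_mult norm_inverse)
    also have "norm (LINT t|lborel. Q t * \<rho> t) \<le> (LINT t|lborel. norm (Q t * \<rho> t))"
      by (rule integral_norm_bound)
    also have "\<dots> \<le> (LINT t|lborel. \<epsilon>\<^sup>2 * C * (t\<^sup>2 * norm (Q t)))"
    proof (rule integral_mono)
      show "norm (Q t * \<rho> t) \<le> \<epsilon>\<^sup>2 * C * (t\<^sup>2 * norm (Q t))" for t
        using mult_left_mono[OF C(2)[of "- \<epsilon> * t"] norm_ge_zero[of "Q t"]]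
        by (simp add: norm_mult \<rho>_def power_mult_distrib mult_ac)
    qed (use int in auto)
    also have "\<dots> = \<epsilon>\<^sup>2 * M"
      by (simp add: M_def)
    finally show ?thesis
      using that by (simp add: field_simps power2_eq_square)
  qed
  show ?thesis
    unfolding L_def[symmetric]
  proof (rule LIM_zero_cancel, rule Lim_null_comparison)
    show "\<forall>\<^sub>F \<epsilon> in at_right 0.
        norm ((LINT x|lborel. of_real ((inverse \<epsilon>)\<^sup>2) * Q (inverse \<epsilon> * (- x)) * \<psi> x) - L) \<le> \<epsilon> * M"
      using eventually_at_right_less by (rule eventually_mono) (rule bound)
    show "((\<lambda>\<epsilon>. \<epsilon> * M) \<longlongrightarrow> 0) (at_right 0)"
      by (auto intro!: tendsto_eq_intros)
  qed
qed

section \<open>The ring of moderate functions and its ideal of negligible functions\<close>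

text \<open>
  Both growth conditions of the Colombeau algebra are instances of this one, with the exponents \<open>-q\<close>
  and \<open>r - q\<close>. A bound on all values is easier to combine than one on a supremum, and real
  exponents can be added.
\<close>

definition growth_bound :: "gen_rep \<Rightarrow> (real \<Rightarrow> complex) \<Rightarrow> real set \<Rightarrow> nat \<Rightarrow> real \<Rightarrow> bool" where
  "growth_bound f \<phi> K p e \<longleftrightarrow>
     (\<exists>C. \<forall>\<^sub>F \<epsilon> in at_right 0. \<forall>x\<in>K. norm (nderiv p (f (rescale \<epsilon> \<phi>)) x) \<le> C * \<epsilon> powr e)"

lemma growth_bound_empty [simp]: "growth_bound f \<phi> {} p e"
  by (simp add: growth_bound_def)

lemma growth_bound_mono:
  assumes "growth_bound f \<phi> K p e" "e' \<le> e"
  shows "growth_bound f \<phi> K p e'"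
proof -
  obtain C where C: "\<forall>\<^sub>F \<epsilon> in at_right 0. \<forall>x\<in>K. norm (nderiv p (f (rescale \<epsilon> \<phi>)) x) \<le> C * \<epsilon> powr e"
    using assms(1) by (auto simp: growth_bound_def)
  have "\<forall>\<^sub>F \<epsilon> in at_right 0. \<epsilon> < (1::real)"
    by (rule eventually_at_right_real[of 0 1, THEN eventually_mono]) auto
  with C eventually_at_right_less
  have "\<forall>\<^sub>F \<epsilon> in at_right 0. \<forall>x\<in>K. norm (nderiv p (f (rescale \<epsilon> \<phi>)) x) \<le> \<bar>C\<bar> * \<epsilon> powr e'"
  proof eventually_elim
    case (elim \<epsilon>)
    have "C * \<epsilon> powr e \<le> \<bar>C\<bar> * \<epsilon> powr e'"
      using elim assms(2) by (intro mult_mono powr_mono') auto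
    then show ?case using elim by fastforce
  qed
  then show ?thesis unfolding growth_bound_def by blast
qed

lemma E_alg_smooth: "f \<in> E_alg \<Longrightarrow> \<phi> \<in> test_moments 0 \<Longrightarrow> smooth (f \<phi>)"
  by (auto simp: E_alg_def)

lemma rescale_test_moments_0: "\<phi> \<in> test_moments q \<Longrightarrow> \<epsilon> > 0 \<Longrightarrow> rescale \<epsilon> \<phi> \<in> test_moments 0"
  using rescale_test_moments test_moments_mono[of 0 q] by blast

lemma E_alg_rescale_smooth:
  "f \<in> E_alg \<Longrightarrow> \<phi> \<in> test_moments q \<Longrightarrow> \<epsilon> > 0 \<Longrightarrow> smooth (f (rescale \<epsilon> \<phi>))"
  by (intro E_alg_smooth rescale_test_moments_0)

text \<open>
  On a nonempty compact set the supremum of the continuous function \<open>\<partial>\<^sup>p f\<close> is at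
  most a number if and only if all values are.
\<close>

lemma SUP_bigo_iff_growth_bound:
  assumes "f \<in> E_alg" "\<phi> \<in> test_moments q" "compact K" "K \<noteq> {}"
    and g: "\<And>\<epsilon>. \<epsilon> > 0 \<Longrightarrow> g \<epsilon> = \<epsilon> powr e"
  shows "(\<lambda>\<epsilon>. SUP x\<in>K. norm (nderiv p (f (rescale \<epsilon> \<phi>)) x)) \<in> O[at_right 0](g) \<longleftrightarrow>
    growth_bound f \<phi> K p e"
proof -
  have SUP: "norm (SUP x\<in>K. norm (nderiv p (f (rescale \<epsilon> \<phi>)) x)) \<le> B \<longleftrightarrow>
      (\<forall>x\<in>K. norm (nderiv p (f (rescale \<epsilon> \<phi>)) x) \<le> B)" if "\<epsilon> > 0" for \<epsilon> B
  proof -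
    have "compact ((\<lambda>x. norm (nderiv p (f (rescale \<epsilon> \<phi>)) x)) ` K)"
      using assms that by (intro compact_continuous_image continuous_intros continuous_on_nderiv
          E_alg_rescale_smooth)
    then have bdd: "bdd_above ((\<lambda>x. norm (nderiv p (f (rescale \<epsilon> \<phi>)) x)) ` K)"
      by (intro bounded_imp_bdd_above compact_imp_bounded)
    obtain x0 where x0: "x0 \<in> K" using assms(4) by blast
    have "0 \<le> (SUP x\<in>K. norm (nderiv p (f (rescale \<epsilon> \<phi>)) x))"
      by (rule order_trans[OF _ cSUP_upper[OF x0 bdd]]) simp
    then show ?thesis
      using cSUP_le_iff[OF assms(4) bdd] by simp
  qed
  have iff: "(\<forall>\<^sub>F \<epsilon> in at_right 0. norm (SUP x\<in>K. norm (nderiv p (f (rescale \<epsilon> \<phi>)) x)) \<le> C * norm (g \<epsilon>)) \<longleftrightarrow>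
      (\<forall>\<^sub>F \<epsilon> in at_right 0. \<forall>x\<in>K. norm (nderiv p (f (rescale \<epsilon> \<phi>)) x) \<le> C * \<epsilon> powr e)" for C
    by (rule eventually_cong[OF eventually_at_right_less]) (simp add: SUP[unfolded real_norm_def] g)
  show ?thesis
  proof
    assume "(\<lambda>\<epsilon>. SUP x\<in>K. norm (nderiv p (f (rescale \<epsilon> \<phi>)) x)) \<in> O[at_right 0](g)"
    then obtain C where "\<forall>\<^sub>F \<epsilon> in at_right 0.
        norm (SUP x\<in>K. norm (nderiv p (f (rescale \<epsilon> \<phi>)) x)) \<le> C * norm (g \<epsilon>)"
      by (elim landau_o.bigE)
    then show "growth_bound f \<phi> K p e"
      unfolding iff growth_bound_def by blast
  next
    assume "growth_bound f \<phi> K p e"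
    then obtain C where "\<forall>\<^sub>F \<epsilon> in at_right 0.
        norm (SUP x\<in>K. norm (nderiv p (f (rescale \<epsilon> \<phi>)) x)) \<le> C * norm (g \<epsilon>)"
      unfolding iff growth_bound_def by blast
    then show "(\<lambda>\<epsilon>. SUP x\<in>K. norm (nderiv p (f (rescale \<epsilon> \<phi>)) x)) \<in> O[at_right 0](g)"
      by (rule bigoI)
  qed
qed

lemma moderate_iff:
  "f \<in> moderate \<longleftrightarrow> f \<in> E_alg \<and> (\<forall>K p. compact K \<longrightarrow>
     (\<exists>q\<ge>1. \<forall>\<phi>\<in>test_moments q. growth_bound f \<phi> K p (- real q)))"
proof -
  have eq: "(\<lambda>\<epsilon>. SUP x\<in>K. norm (nderiv p (f (rescale \<epsilon> \<phi>)) x)) \<in> O[at_right 0](\<lambda>\<epsilon>. \<epsilon> powi (- int q)) \<longleftrightarrow>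
      growth_bound f \<phi> K p (- real q)"
    if "f \<in> E_alg" "\<phi> \<in> test_moments q" "compact K" "K \<noteq> {}" for K p \<phi> and q :: nat
    by (rule SUP_bigo_iff_growth_bound[OF that])
       (use powr_real_of_int'[of _ "- int q"] in simp)
  have "(compact K \<and> K \<noteq> {} \<longrightarrow> (\<exists>q\<ge>1. \<forall>\<phi>\<in>test_moments q.
      (\<lambda>\<epsilon>. SUP x\<in>K. norm (nderiv p (f (rescale \<epsilon> \<phi>)) x)) \<in> O[at_right 0](\<lambda>\<epsilon>. \<epsilon> powi (- int q)))) \<longleftrightarrow>
      (compact K \<longrightarrow> (\<exists>q\<ge>1. \<forall>\<phi>\<in>test_moments q. growth_bound f \<phi> K p (- real q)))"
    if "f \<in> E_alg" for K p
  proof (cases "compact K \<and> K \<noteq> {}")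
    case True
    then show ?thesis
      by (simp add: eq[OF that] cong: ball_cong)
  next
    case False
    then show ?thesis by (auto intro!: exI[of _ 1])
  qed
  note K = this
  show ?thesis
    unfolding moderate_def mem_Collect_eq by (intro conj_cong refl) (simp only: K)
qed

lemma negligible_reps_iff:
  "f \<in> negligible_reps \<longleftrightarrow> f \<in> moderate \<and> (\<forall>K p. compact K \<longrightarrow>
     (\<exists>q\<ge>1. \<forall>r\<ge>q. \<forall>\<phi>\<in>test_moments r. growth_bound f \<phi> K p (real r - real q)))"
proof -
  have eq: "(\<lambda>\<epsilon>. SUP x\<in>K. norm (nderiv p (f (rescale \<epsilon> \<phi>)) x)) \<in> O[at_right 0](\<lambda>\<epsilon>. \<epsilon> ^ (r - q)) \<longleftrightarrow>
      growth_bound f \<phi> K p (real r - real q)"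
    if "f \<in> E_alg" "\<phi> \<in> test_moments r" "compact K" "K \<noteq> {}" "r \<ge> q" for K p \<phi> and q r :: nat
    by (rule SUP_bigo_iff_growth_bound[OF that(1-4)])
       (use that(5) in \<open>simp add: of_nat_diff flip: powr_realpow\<close>)
  have "(compact K \<and> K \<noteq> {} \<longrightarrow> (\<exists>q\<ge>1. \<forall>r\<ge>q. \<forall>\<phi>\<in>test_moments r.
      (\<lambda>\<epsilon>. SUP x\<in>K. norm (nderiv p (f (rescale \<epsilon> \<phi>)) x)) \<in> O[at_right 0](\<lambda>\<epsilon>. \<epsilon> ^ (r - q)))) \<longleftrightarrow>
      (compact K \<longrightarrow> (\<exists>q\<ge>1. \<forall>r\<ge>q. \<forall>\<phi>\<in>test_moments r. growth_bound f \<phi> K p (real r - real q)))"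
    if "f \<in> moderate" for K p
  proof (cases "compact K \<and> K \<noteq> {}")
    case True
    moreover have "f \<in> E_alg"
      using that by (simp add: moderate_iff)
    ultimately show ?thesis
      by (simp add: eq cong: ball_cong)
  next
    case False
    then show ?thesis by (auto intro!: exI[of _ 1])
  qed
  note K = this
  show ?thesis
    unfolding negligible_reps_def mem_Collect_eq by (intro conj_cong refl) (simp only: K)
qed

text \<open>
  Leibniz' rule needs all derivatives up to order \<open>p\<close> at once; the sum of the finitely many \<open>q\<close> serves
  for all of them.
\<close>

lemma moderate_uniform:
  assumes "f \<in> moderate" "compact K"
  obtains q where "q \<ge> 1"
    "\<And>j \<phi>. j \<le> p \<Longrightarrow> \<phi> \<in> test_moments q \<Longrightarrow> growth_bound f \<phi> K j (- real q)"
proof -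
  have "\<forall>j. \<exists>q\<ge>1. \<forall>\<phi>\<in>test_moments q. growth_bound f \<phi> K j (- real q)"
    using assms by (simp add: moderate_iff)
  from choice[OF this]
  obtain q where q: "\<And>j. q j \<ge> 1" "\<And>j \<phi>. \<phi> \<in> test_moments (q j) \<Longrightarrow> growth_bound f \<phi> K j (- real (q j))"
    by auto
  have le: "q j \<le> (\<Sum>j\<le>p. q j)" if "j \<le> p" for j
    using that by (intro member_le_sum) auto
  show ?thesis
  proof (rule that[of "\<Sum>j\<le>p. q j"])
    show "(\<Sum>j\<le>p. q j) \<ge> 1" using q(1)[of 0] le[of 0] by simp
    show "growth_bound f \<phi> K j (- real (\<Sum>j\<le>p. q j))"
      if "j \<le> p" "\<phi> \<in> test_moments (\<Sum>j\<le>p. q j)" for j \<phi>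
    proof (rule growth_bound_mono[OF q(2)])
      show "\<phi> \<in> test_moments (q j)"
        using that test_moments_mono[OF le[of j]] by blast
      show "- real (\<Sum>j\<le>p. q j) \<le> - real (q j)"
        using le[OF that(1)] by (simp del: of_nat_sum)
    qed
  qed
qed

lemma negligible_uniform:
  assumes "f \<in> negligible_reps" "compact K"
  obtains q where "q \<ge> 1"
    "\<And>j r \<phi>. j \<le> p \<Longrightarrow> r \<ge> q \<Longrightarrow> \<phi> \<in> test_moments r \<Longrightarrow> growth_bound f \<phi> K j (real r - real q)"
proof -
  have "\<forall>j. \<exists>q\<ge>1. \<forall>r\<ge>q. \<forall>\<phi>\<in>test_moments r. growth_bound f \<phi> K j (real r - real q)"
    using assms by (simp add: negligible_reps_iff)
  then obtain q where q: "\<And>j. q j \<ge> 1"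
    "\<And>j r \<phi>. r \<ge> q j \<Longrightarrow> \<phi> \<in> test_moments r \<Longrightarrow> growth_bound f \<phi> K j (real r - real (q j))"
    by metis
  have le: "q j \<le> (\<Sum>j\<le>p. q j)" if "j \<le> p" for j
    using that by (intro member_le_sum) auto
  show ?thesis
  proof (rule that[of "\<Sum>j\<le>p. q j"])
    show "(\<Sum>j\<le>p. q j) \<ge> 1" using q(1)[of 0] le[of 0] by simp
    show "growth_bound f \<phi> K j (real r - real (\<Sum>j\<le>p. q j))"
      if "j \<le> p" "r \<ge> (\<Sum>j\<le>p. q j)" "\<phi> \<in> test_moments r" for j r \<phi>
    proof (rule growth_bound_mono[OF q(2)])
      show "r \<ge> q j"
        using that(2) le[OF that(1)] by simp
      show "real r - real (\<Sum>j\<le>p. q j) \<le> real r - real (q j)"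
        using le[OF that(1)] by (simp del: of_nat_sum)
    qed fact
  qed
qed

lemma EM_simps:
  "carrier EM = moderate"
  "f \<otimes>\<^bsub>EM\<^esub> g = (\<lambda>\<phi>\<in>test_moments 0. \<lambda>x. f \<phi> x * g \<phi> x)"
  "f \<oplus>\<^bsub>EM\<^esub> g = (\<lambda>\<phi>\<in>test_moments 0. \<lambda>x. f \<phi> x + g \<phi> x)"
  "\<one>\<^bsub>EM\<^esub> = (\<lambda>\<phi>\<in>test_moments 0. \<lambda>x. 1)"
  "\<zero>\<^bsub>EM\<^esub> = (\<lambda>\<phi>\<in>test_moments 0. \<lambda>x. 0)"
  by (simp_all add: EM_def)

lemma E_alg_mult: "f \<in> E_alg \<Longrightarrow> g \<in> E_alg \<Longrightarrow> f \<otimes>\<^bsub>EM\<^esub> g \<in> E_alg"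
  unfolding EM_simps E_alg_def by (auto intro!: smooth_mult)

lemma E_alg_add: "f \<in> E_alg \<Longrightarrow> g \<in> E_alg \<Longrightarrow> f \<oplus>\<^bsub>EM\<^esub> g \<in> E_alg"
  unfolding EM_simps E_alg_def by (auto intro!: smooth_add)

lemma growth_bound_add:
  assumes "f \<in> E_alg" "g \<in> E_alg" "\<phi> \<in> test_moments q"
    and "growth_bound f \<phi> K p e" "growth_bound g \<phi> K p e"
  shows "growth_bound (f \<oplus>\<^bsub>EM\<^esub> g) \<phi> K p e"
proof -
  obtain C D where
    "\<forall>\<^sub>F \<epsilon> in at_right 0. \<forall>x\<in>K. norm (nderiv p (f (rescale \<epsilon> \<phi>)) x) \<le> C * \<epsilon> powr e"
    "\<forall>\<^sub>F \<epsilon> in at_right 0. \<forall>x\<in>K. norm (nderiv p (g (rescale \<epsilon> \<phi>)) x) \<le> D * \<epsilon> powr e"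
    using assms(4,5) by (auto simp: growth_bound_def)
  with eventually_at_right_less
  have "\<forall>\<^sub>F \<epsilon> in at_right 0. \<forall>x\<in>K.
      norm (nderiv p ((f \<oplus>\<^bsub>EM\<^esub> g) (rescale \<epsilon> \<phi>)) x) \<le> (C + D) * \<epsilon> powr e"
  proof eventually_elim
    case (elim \<epsilon>)
    have "nderiv p ((f \<oplus>\<^bsub>EM\<^esub> g) (rescale \<epsilon> \<phi>)) x =
        nderiv p (f (rescale \<epsilon> \<phi>)) x + nderiv p (g (rescale \<epsilon> \<phi>)) x" for x
      using elim(1) assms(1-3)
      by (simp add: EM_simps rescale_test_moments_0 nderiv_add E_alg_rescale_smooth)
    then show ?case
      using elim(2,3) by (auto simp: distrib_right intro!: norm_triangle_le add_mono)
  qed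
  then show ?thesis unfolding growth_bound_def by blast
qed

lemma growth_bound_mult:
  assumes "f \<in> E_alg" "g \<in> E_alg" "\<phi> \<in> test_moments q"
    and "\<And>j. j \<le> p \<Longrightarrow> growth_bound f \<phi> K j e" "\<And>j. j \<le> p \<Longrightarrow> growth_bound g \<phi> K j e'"
  shows "growth_bound (f \<otimes>\<^bsub>EM\<^esub> g) \<phi> K p (e + e')"
proof -
  define Pf where "Pf = (\<lambda>j C. \<forall>\<^sub>F \<epsilon> in at_right 0. \<forall>x\<in>K.
    norm (nderiv j (f (rescale \<epsilon> \<phi>)) x) \<le> C * \<epsilon> powr e)"
  define Pg where "Pg = (\<lambda>j C. \<forall>\<^sub>F \<epsilon> in at_right 0. \<forall>x\<in>K.
    norm (nderiv j (g (rescale \<epsilon> \<phi>)) x) \<le> C * \<epsilon> powr e')"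
  have "\<exists>C. Pf j C" "\<exists>D. Pg j D" if "j \<le> p" for j
    using assms(4,5)[OF that] by (simp_all add: growth_bound_def Pf_def Pg_def)
  then obtain C D where CD: "\<And>j. j \<le> p \<Longrightarrow> Pf j (C j)" "\<And>j. j \<le> p \<Longrightarrow> Pg j (D j)"
    by metis
  define B where "B = (\<Sum>k\<le>p. of_nat (p choose k) * \<bar>C k\<bar> * \<bar>D (p - k)\<bar>)"
  have "\<forall>\<^sub>F \<epsilon> in at_right 0. \<forall>j\<in>{..p}. \<forall>x\<in>K. norm (nderiv j (f (rescale \<epsilon> \<phi>)) x) \<le> C j * \<epsilon> powr e"
    by (rule eventually_ball_finite) (use CD(1) in \<open>simp_all add: Pf_def\<close>)
  moreover have "\<forall>\<^sub>F \<epsilon> in at_right 0. \<forall>j\<in>{..p}. \<forall>x\<in>K. norm (nderiv j (g (rescale \<epsilon> \<phi>)) x) \<le> D j * \<epsilon> powr e'"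
    by (rule eventually_ball_finite) (use CD(2) in \<open>simp_all add: Pg_def\<close>)
  moreover note eventually_at_right_less
  ultimately have "\<forall>\<^sub>F \<epsilon> in at_right 0. \<forall>x\<in>K.
      norm (nderiv p ((f \<otimes>\<^bsub>EM\<^esub> g) (rescale \<epsilon> \<phi>)) x) \<le> B * \<epsilon> powr (e + e')"
  proof eventually_elim
    case (elim \<epsilon>)
    show ?case
    proof
      fix x assume x: "x \<in> K"
      have bf: "norm (nderiv k (f (rescale \<epsilon> \<phi>)) x) \<le> \<bar>C k\<bar> * \<epsilon> powr e" if "k \<le> p" for k
      proof (rule order_trans)
        show "norm (nderiv k (f (rescale \<epsilon> \<phi>)) x) \<le> C k * \<epsilon> powr e"
          using elim(1) x that by simp
      qed (intro mult_right_mono, auto)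
      have bg: "norm (nderiv k (g (rescale \<epsilon> \<phi>)) x) \<le> \<bar>D k\<bar> * \<epsilon> powr e'" if "k \<le> p" for k
      proof (rule order_trans)
        show "norm (nderiv k (g (rescale \<epsilon> \<phi>)) x) \<le> D k * \<epsilon> powr e'"
          using elim(2) x that by simp
      qed (intro mult_right_mono, auto)
      have leibniz: "nderiv p ((f \<otimes>\<^bsub>EM\<^esub> g) (rescale \<epsilon> \<phi>)) x = (\<Sum>k\<le>p. of_nat (p choose k) *
          nderiv k (f (rescale \<epsilon> \<phi>)) x * nderiv (p - k) (g (rescale \<epsilon> \<phi>)) x)"
        using elim(3) assms(1-3)
        by (simp add: EM_simps rescale_test_moments_0 nderiv_mult E_alg_rescale_smooth)
      have "norm (nderiv p ((f \<otimes>\<^bsub>EM\<^esub> g) (rescale \<epsilon> \<phi>)) x) \<le>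
          (\<Sum>k\<le>p. of_nat (p choose k) * (\<bar>C k\<bar> * \<epsilon> powr e) * (\<bar>D (p - k)\<bar> * \<epsilon> powr e'))"
        unfolding leibniz
      proof (rule sum_norm_le)
        fix k assume k: "k \<in> {..p}"
        show "norm (of_nat (p choose k) * nderiv k (f (rescale \<epsilon> \<phi>)) x *
            nderiv (p - k) (g (rescale \<epsilon> \<phi>)) x) \<le>
            of_nat (p choose k) * (\<bar>C k\<bar> * \<epsilon> powr e) * (\<bar>D (p - k)\<bar> * \<epsilon> powr e')"
          unfolding norm_mult norm_of_nat using k by (intro mult_mono order_refl bf bg) auto
      qed
      also have "\<dots> = B * \<epsilon> powr (e + e')"
        unfolding B_def sum_distrib_right by (intro sum.cong refl) (simp only: powr_add mult_ac)
      finally show "norm (nderiv p ((f \<otimes>\<^bsub>EM\<^esub> g) (rescale \<epsilon> \<phi>)) x) \<le> B * \<epsilon> powr (e + e')" .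
    qed
  qed
  then show ?thesis unfolding growth_bound_def by blast
qed

lemma moderate_E_alg: "f \<in> moderate \<Longrightarrow> f \<in> E_alg"
  by (simp add: moderate_iff)

lemma negligible_moderate: "f \<in> negligible_reps \<Longrightarrow> f \<in> moderate"
  by (simp add: negligible_reps_iff)

lemma moderate_mult:
  assumes "f \<in> moderate" "g \<in> moderate"
  shows "f \<otimes>\<^bsub>EM\<^esub> g \<in> moderate"
  unfolding moderate_iff
proof (intro conjI allI impI)
  show "f \<otimes>\<^bsub>EM\<^esub> g \<in> E_alg"
    by (intro E_alg_mult moderate_E_alg assms)
  fix K p assume "compact (K :: real set)"
  obtain q where q: "q \<ge> 1"
    "\<And>j \<phi>. j \<le> p \<Longrightarrow> \<phi> \<in> test_moments q \<Longrightarrow> growth_bound f \<phi> K j (- real q)"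
    using moderate_uniform[OF assms(1) \<open>compact K\<close>] by blast
  obtain q' where q': "q' \<ge> 1"
    "\<And>j \<phi>. j \<le> p \<Longrightarrow> \<phi> \<in> test_moments q' \<Longrightarrow> growth_bound g \<phi> K j (- real q')"
    using moderate_uniform[OF assms(2) \<open>compact K\<close>] by blast
  have "growth_bound (f \<otimes>\<^bsub>EM\<^esub> g) \<phi> K p (- real (q + q'))" if "\<phi> \<in> test_moments (q + q')" for \<phi>
  proof -
    have "\<phi> \<in> test_moments q" "\<phi> \<in> test_moments q'"
      using that test_moments_mono[of q "q + q'"] test_moments_mono[of q' "q + q'"] by auto
    then have "growth_bound (f \<otimes>\<^bsub>EM\<^esub> g) \<phi> K p (- real q + - real q')"
      using assms that by (intro growth_bound_mult q q' moderate_E_alg)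
    then show ?thesis by simp
  qed
  then show "\<exists>q\<ge>1. \<forall>\<phi>\<in>test_moments q. growth_bound (f \<otimes>\<^bsub>EM\<^esub> g) \<phi> K p (- real q)"
    using q(1) by (intro exI[of _ "q + q'"]) auto
qed

lemma negligible_mult:
  assumes "f \<in> negligible_reps" "g \<in> moderate"
  shows "f \<otimes>\<^bsub>EM\<^esub> g \<in> negligible_reps"
  unfolding negligible_reps_iff
proof (intro conjI allI impI)
  show "f \<otimes>\<^bsub>EM\<^esub> g \<in> moderate"
    by (intro moderate_mult negligible_moderate assms)
  fix K p assume "compact (K :: real set)"
  obtain q where q: "q \<ge> 1"
    "\<And>j r \<phi>. j \<le> p \<Longrightarrow> r \<ge> q \<Longrightarrow> \<phi> \<in> test_moments r \<Longrightarrow> growth_bound f \<phi> K j (real r - real q)"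
    using negligible_uniform[OF assms(1) \<open>compact K\<close>] by blast
  obtain q' where q': "q' \<ge> 1"
    "\<And>j \<phi>. j \<le> p \<Longrightarrow> \<phi> \<in> test_moments q' \<Longrightarrow> growth_bound g \<phi> K j (- real q')"
    using moderate_uniform[OF assms(2) \<open>compact K\<close>] by blast
  have "growth_bound (f \<otimes>\<^bsub>EM\<^esub> g) \<phi> K p (real r - real (q + q'))"
    if "r \<ge> q + q'" "\<phi> \<in> test_moments r" for \<phi> r
  proof -
    have "\<phi> \<in> test_moments q'"
      using that test_moments_mono[of q' r] by auto
    then have "growth_bound (f \<otimes>\<^bsub>EM\<^esub> g) \<phi> K p ((real r - real q) + - real q')"
      using assms that
      by (intro growth_bound_mult q q' moderate_E_alg negligible_moderate[OF assms(1)]) auto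
    then show ?thesis by (simp add: algebra_simps)
  qed
  then show "\<exists>q\<ge>1. \<forall>r\<ge>q. \<forall>\<phi>\<in>test_moments r. growth_bound (f \<otimes>\<^bsub>EM\<^esub> g) \<phi> K p (real r - real q)"
    using q(1) by (intro exI[of _ "q + q'"]) auto
qed

lemma moderate_add:
  assumes "f \<in> moderate" "g \<in> moderate"
  shows "f \<oplus>\<^bsub>EM\<^esub> g \<in> moderate"
  unfolding moderate_iff
proof (intro conjI allI impI)
  show "f \<oplus>\<^bsub>EM\<^esub> g \<in> E_alg"
    by (intro E_alg_add moderate_E_alg assms)
  fix K p assume "compact (K :: real set)"
  obtain q where q: "q \<ge> 1"
    "\<And>j \<phi>. j \<le> p \<Longrightarrow> \<phi> \<in> test_moments q \<Longrightarrow> growth_bound f \<phi> K j (- real q)"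
    using moderate_uniform[OF assms(1) \<open>compact K\<close>] by blast
  obtain q' where q': "q' \<ge> 1"
    "\<And>j \<phi>. j \<le> p \<Longrightarrow> \<phi> \<in> test_moments q' \<Longrightarrow> growth_bound g \<phi> K j (- real q')"
    using moderate_uniform[OF assms(2) \<open>compact K\<close>] by blast
  have "growth_bound (f \<oplus>\<^bsub>EM\<^esub> g) \<phi> K p (- real (q + q'))" if "\<phi> \<in> test_moments (q + q')" for \<phi>
  proof -
    have "\<phi> \<in> test_moments q" "\<phi> \<in> test_moments q'"
      using that test_moments_mono[of q "q + q'"] test_moments_mono[of q' "q + q'"] by auto
    then show ?thesis
      using assms that
      by (intro growth_bound_add growth_bound_mono[OF q(2)[of p]] growth_bound_mono[OF q'(2)[of p]]
          moderate_E_alg) auto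
  qed
  then show "\<exists>q\<ge>1. \<forall>\<phi>\<in>test_moments q. growth_bound (f \<oplus>\<^bsub>EM\<^esub> g) \<phi> K p (- real q)"
    using q(1) by (intro exI[of _ "q + q'"]) auto
qed

lemma negligible_add:
  assumes "f \<in> negligible_reps" "g \<in> negligible_reps"
  shows "f \<oplus>\<^bsub>EM\<^esub> g \<in> negligible_reps"
  unfolding negligible_reps_iff
proof (intro conjI allI impI)
  show "f \<oplus>\<^bsub>EM\<^esub> g \<in> moderate"
    by (intro moderate_add negligible_moderate assms)
  fix K p assume "compact (K :: real set)"
  obtain q where q: "q \<ge> 1"
    "\<And>j r \<phi>. j \<le> p \<Longrightarrow> r \<ge> q \<Longrightarrow> \<phi> \<in> test_moments r \<Longrightarrow> growth_bound f \<phi> K j (real r - real q)"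
    using negligible_uniform[OF assms(1) \<open>compact K\<close>] by blast
  obtain q' where q': "q' \<ge> 1"
    "\<And>j r \<phi>. j \<le> p \<Longrightarrow> r \<ge> q' \<Longrightarrow> \<phi> \<in> test_moments r \<Longrightarrow> growth_bound g \<phi> K j (real r - real q')"
    using negligible_uniform[OF assms(2) \<open>compact K\<close>] by blast
  have "growth_bound (f \<oplus>\<^bsub>EM\<^esub> g) \<phi> K p (real r - real (q + q'))"
    if "r \<ge> q + q'" "\<phi> \<in> test_moments r" for \<phi> r
    using assms that
    by (intro growth_bound_add growth_bound_mono[OF q(2)[of p r]] growth_bound_mono[OF q'(2)[of p r]]
        moderate_E_alg negligible_moderate) auto
  then show "\<exists>q\<ge>1. \<forall>r\<ge>q. \<forall>\<phi>\<in>test_moments r. growth_bound (f \<oplus>\<^bsub>EM\<^esub> g) \<phi> K p (real r - real q)"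
    using q(1) by (intro exI[of _ "q + q'"]) auto
qed

lemma growth_bound_const:
  assumes "\<phi> \<in> test_moments q" "c = 0 \<or> e \<le> 0"
  shows "growth_bound (\<lambda>\<phi>\<in>test_moments 0. \<lambda>x. c) \<phi> K p e"
proof (rule growth_bound_mono)
  show "growth_bound (\<lambda>\<phi>\<in>test_moments 0. \<lambda>x. c) \<phi> K p (if c = 0 then e else 0)"
    unfolding growth_bound_def
    by (intro exI[of _ "norm c"] eventually_mono[OF eventually_at_right_less])
       (use assms in \<open>auto simp: rescale_test_moments_0 nderiv_const\<close>)
  show "e \<le> (if c = 0 then e else 0)" using assms(2) by auto
qed

lemma const_moderate: "(\<lambda>\<phi>\<in>test_moments 0. \<lambda>x. c) \<in> moderate"
  unfolding moderate_iff
  by (auto simp: E_alg_def smooth_const intro!: exI[of _ 1] growth_bound_const)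

lemma zero_negligible: "\<zero>\<^bsub>EM\<^esub> \<in> negligible_reps"
  unfolding negligible_reps_iff EM_simps
  by (auto simp: const_moderate intro!: exI[of _ 1] growth_bound_const)

lemma moderate_extensional: "f \<in> moderate \<Longrightarrow> \<phi> \<notin> test_moments 0 \<Longrightarrow> f \<phi> = undefined"
  by (auto simp: moderate_iff E_alg_def)

definition EM_neg :: "gen_rep \<Rightarrow> gen_rep" where
  "EM_neg f = (\<lambda>\<phi>\<in>test_moments 0. \<lambda>x. - f \<phi> x)"

lemma EM_neg_altdef: "EM_neg f = f \<otimes>\<^bsub>EM\<^esub> (\<lambda>\<phi>\<in>test_moments 0. \<lambda>x. - 1)"
  by (auto simp: EM_neg_def EM_simps restrict_def)

lemma EM_neg_moderate: "f \<in> moderate \<Longrightarrow> EM_neg f \<in> moderate"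
  unfolding EM_neg_altdef by (intro moderate_mult const_moderate)

lemma EM_neg_negligible: "f \<in> negligible_reps \<Longrightarrow> EM_neg f \<in> negligible_reps"
  unfolding EM_neg_altdef by (intro negligible_mult const_moderate)

lemma EM_neg_add: "EM_neg f \<oplus>\<^bsub>EM\<^esub> f = \<zero>\<^bsub>EM\<^esub>"
  by (auto simp: EM_neg_def EM_simps restrict_def)

lemma EM_comm_monoid: "comm_monoid EM"
proof (rule comm_monoidI)
  fix f g h assume "f \<in> carrier EM" "g \<in> carrier EM" "h \<in> carrier EM"
  show "f \<otimes>\<^bsub>EM\<^esub> g \<otimes>\<^bsub>EM\<^esub> h = f \<otimes>\<^bsub>EM\<^esub> (g \<otimes>\<^bsub>EM\<^esub> h)"
    by (auto simp: EM_simps restrict_def mult.assoc)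
next
  fix f g assume "f \<in> carrier EM" "g \<in> carrier EM"
  then show "f \<otimes>\<^bsub>EM\<^esub> g \<in> carrier EM"
    using moderate_mult by (simp add: EM_simps(1))
  show "f \<otimes>\<^bsub>EM\<^esub> g = g \<otimes>\<^bsub>EM\<^esub> f"
    by (auto simp: EM_simps restrict_def mult.commute)
next
  show "\<one>\<^bsub>EM\<^esub> \<in> carrier EM"
    using const_moderate by (simp add: EM_simps)
  fix f assume "f \<in> carrier EM"
  then show "\<one>\<^bsub>EM\<^esub> \<otimes>\<^bsub>EM\<^esub> f = f"
    by (auto simp: EM_simps restrict_def moderate_extensional)
qed

lemma EM_abelian_group: "abelian_group EM"
proof (rule abelian_groupI)
  fix f g h assume "f \<in> carrier EM" "g \<in> carrier EM" "h \<in> carrier EM"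
  show "f \<oplus>\<^bsub>EM\<^esub> g \<oplus>\<^bsub>EM\<^esub> h = f \<oplus>\<^bsub>EM\<^esub> (g \<oplus>\<^bsub>EM\<^esub> h)"
    by (auto simp: EM_simps restrict_def add.assoc)
next
  fix f g assume "f \<in> carrier EM" "g \<in> carrier EM"
  then show "f \<oplus>\<^bsub>EM\<^esub> g \<in> carrier EM"
    using moderate_add by (simp add: EM_simps(1))
  show "f \<oplus>\<^bsub>EM\<^esub> g = g \<oplus>\<^bsub>EM\<^esub> f"
    by (auto simp: EM_simps restrict_def add.commute)
next
  show "\<zero>\<^bsub>EM\<^esub> \<in> carrier EM"
    using const_moderate by (simp add: EM_simps)
  fix f assume f: "f \<in> carrier EM"
  then show "\<zero>\<^bsub>EM\<^esub> \<oplus>\<^bsub>EM\<^esub> f = f"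
    by (auto simp: EM_simps restrict_def moderate_extensional)
  show "\<exists>g\<in>carrier EM. g \<oplus>\<^bsub>EM\<^esub> f = \<zero>\<^bsub>EM\<^esub>"
    using f EM_neg_add EM_neg_moderate by (auto simp: EM_simps(1))
qed

lemma EM_cring: "cring EM"
proof (rule cringI[OF EM_abelian_group EM_comm_monoid])
  fix f g h
  show "(f \<oplus>\<^bsub>EM\<^esub> g) \<otimes>\<^bsub>EM\<^esub> h = f \<otimes>\<^bsub>EM\<^esub> h \<oplus>\<^bsub>EM\<^esub> g \<otimes>\<^bsub>EM\<^esub> h"
    by (auto simp: EM_simps restrict_def distrib_right)
qed

lemma EM_a_inv: "f \<in> moderate \<Longrightarrow> \<ominus>\<^bsub>EM\<^esub> f = EM_neg f"
  by (rule abelian_group.minus_equality[OF EM_abelian_group EM_neg_add])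
     (simp_all add: EM_simps(1) EM_neg_moderate)

lemma negligible_ideal: "ideal negligible_reps EM"
proof (rule idealI)
  show "ring EM"
    using EM_cring by (rule cring.axioms)
  interpret A: group "add_monoid EM"
    using EM_abelian_group by (rule abelian_group.a_group)
  show "subgroup negligible_reps (add_monoid EM)"
  proof (rule A.subgroupI)
    show "negligible_reps \<subseteq> carrier (add_monoid EM)"
      using negligible_moderate by (auto simp: EM_simps(1))
    show "negligible_reps \<noteq> {}"
      using zero_negligible by blast
    fix f assume "f \<in> negligible_reps"
    then have "\<ominus>\<^bsub>EM\<^esub> f \<in> negligible_reps"
      using EM_a_inv EM_neg_negligible negligible_moderate by simp
    then show "inv\<^bsub>add_monoid EM\<^esub> f \<in> negligible_reps"
      by (simp add: a_inv_def)
  next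
    fix f g assume "f \<in> negligible_reps" "g \<in> negligible_reps"
    then show "f \<otimes>\<^bsub>add_monoid EM\<^esub> g \<in> negligible_reps"
      using negligible_add by simp
  qed
  fix f g assume fg: "f \<in> negligible_reps" "g \<in> carrier EM"
  then show "f \<otimes>\<^bsub>EM\<^esub> g \<in> negligible_reps"
    using negligible_mult by (simp add: EM_simps(1))
  moreover have "g \<otimes>\<^bsub>EM\<^esub> f = f \<otimes>\<^bsub>EM\<^esub> g"
    by (auto simp: EM_simps restrict_def mult.commute)
  ultimately show "g \<otimes>\<^bsub>EM\<^esub> f \<in> negligible_reps"
    by simp
qed

text \<open>
  The projection to the quotient is a ring homomorphism, so that the operations of the Colombeau
  algebra can be carried out on representatives.
\<close>

lemma Colombeau_mult_diff_cosets:
  assumes "f \<in> moderate" "g \<in> moderate" "h \<in> moderate" "k \<in> moderate"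
  defines "F \<equiv> ((negligible_reps +>\<^bsub>EM\<^esub> f) \<otimes>\<^bsub>Colombeau\<^esub> (negligible_reps +>\<^bsub>EM\<^esub> g)) \<ominus>\<^bsub>Colombeau\<^esub>
    ((negligible_reps +>\<^bsub>EM\<^esub> h) \<otimes>\<^bsub>Colombeau\<^esub> (negligible_reps +>\<^bsub>EM\<^esub> k))"
  shows "F \<in> carrier Colombeau"
    and "(\<lambda>\<phi>\<in>test_moments 0. \<lambda>x. f \<phi> x * g \<phi> x - h \<phi> x * k \<phi> x) \<in> F"
proof -
  interpret I: ideal negligible_reps EM
    by (rule negligible_ideal)
  interpret H: ring_hom_ring EM Colombeau "(+>\<^bsub>EM\<^esub>) negligible_reps"
    unfolding Colombeau_def by (rule I.rcos_ring_hom_ring)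
  define z where "z = f \<otimes>\<^bsub>EM\<^esub> g \<oplus>\<^bsub>EM\<^esub> (\<ominus>\<^bsub>EM\<^esub> (h \<otimes>\<^bsub>EM\<^esub> k))"
  have carr: "f \<in> carrier EM" "g \<in> carrier EM" "h \<in> carrier EM" "k \<in> carrier EM"
    using assms by (simp_all add: EM_simps(1))
  then have z: "z \<in> carrier EM"
    unfolding z_def by (intro I.add.m_closed I.m_closed I.a_inv_closed)
  have F: "F = negligible_reps +>\<^bsub>EM\<^esub> z"
    unfolding F_def z_def a_minus_def using carr
    by (simp add: H.hom_add H.hom_mult H.hom_a_inv)
  show "F \<in> carrier Colombeau"
    unfolding F by (rule H.hom_closed[OF z])
  have "z = (\<lambda>\<phi>\<in>test_moments 0. \<lambda>x. f \<phi> x * g \<phi> x - h \<phi> x * k \<phi> x)"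
    unfolding z_def EM_a_inv[OF moderate_mult[OF assms(3,4)]]
    by (auto simp: EM_simps EM_neg_def restrict_def)
  then show "(\<lambda>\<phi>\<in>test_moments 0. \<lambda>x. f \<phi> x * g \<phi> x - h \<phi> x * k \<phi> x) \<in> F"
    using I.a_rcos_self[OF z] F by simp
qed

section \<open>Embedded distributions\<close>

lemma funpow_dist_deriv: "(dist_deriv ^^ r) u \<psi> = (-1) ^ r * u (nderiv r \<psi>)"
proof (induction r arbitrary: \<psi>)
  case (Suc r)
  have "(dist_deriv ^^ Suc r) u \<psi> = - (dist_deriv ^^ r) u (nderiv 1 \<psi>)"
    by (simp add: dist_deriv_def)
  also have "\<dots> = (-1) ^ Suc r * u (nderiv (Suc r) \<psi>)"
    unfolding Suc by (simp add: nderiv_nderiv)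
  finally show ?case .
qed simp

lemma nu_shift: "a + real (nu_shift a) > -1"
proof -
  obtain n where "- 1 - a < real n"
    using reals_Archimedean2 by blast
  then have "a + real n > -1" by simp
  then show ?thesis
    unfolding nu_shift_def by (rule LeastI)
qed

lemma nderiv_translate:
  assumes "smooth \<phi>"
  shows "nderiv n (\<lambda>y. reflect \<phi> (x - y)) = (\<lambda>y. nderiv n \<phi> (y - x))"
proof -
  have "(\<lambda>y. reflect \<phi> (x - y)) = (\<lambda>y. \<phi> (1 * y + - x))"
    by (simp add: reflect_def)
  then show ?thesis
    using nderiv_affine[OF assms, of n 1 "- x"] by simp
qed

lemma convolve_nu_plus:
  assumes "smooth \<phi>"
  shows "convolve (nu_plus a) (reflect \<phi>) x =
    (-1) ^ nu_shift a * frac_right (a + real (nu_shift a)) (nderiv (nu_shift a) \<phi>) (- x)"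
proof -
  have nu: "nu_plus_fun c y * z = power_kernel c y *\<^sub>R z" for c y z
    by (simp add: nu_plus_fun_def power_kernel_def scaleR_conv_of_real)
  show ?thesis
    unfolding convolve_def nu_plus_def Let_def funpow_dist_deriv nderiv_translate[OF assms]
      dist_of_fun_def nu frac_right_def by (simp add: add.commute)
qed

lemma convolve_nu_minus:
  assumes "smooth \<phi>"
  shows "convolve (nu_minus b) (reflect \<phi>) x =
    frac_left (b + real (nu_shift b)) (nderiv (nu_shift b) \<phi>) (- x)"
proof -
  define c where "c = b + real (nu_shift b)"
  have nu: "nu_minus_fun c y * z = power_kernel c (- y) *\<^sub>R z" for y z
    by (simp add: nu_minus_fun_def power_kernel_def scaleR_conv_of_real)
  have "(LINT y|lborel. power_kernel c (- y) *\<^sub>R nderiv (nu_shift b) \<phi> (y - x)) =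
      \<bar>-1\<bar> *\<^sub>R (LINT y|lborel. power_kernel c (- (0 + (-1) * y)) *\<^sub>R
        nderiv (nu_shift b) \<phi> ((0 + (-1) * y) - x))"
    by (rule lborel_integral_real_affine) simp
  also have "\<dots> = frac_left c (nderiv (nu_shift b) \<phi>) (- x)"
    unfolding frac_left_def abs_minus_cancel abs_one scaleR_one
    by (intro Bochner_Integration.integral_cong refl) (simp add: minus_diff_commute)
  finally show ?thesis
    unfolding convolve_def nu_minus_def Let_def dist_scale_def funpow_dist_deriv
      nderiv_translate[OF assms] dist_of_fun_def c_def[symmetric] nu
    by (simp flip: mult.assoc power_mult_distrib)
qed

lemma convolve_dirac: "convolve dirac (reflect \<phi>) x = \<phi> (- x)"
  by (simp add: convolve_def dirac_def reflect_def)

text \<open>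
  Convolution with a distribution of finite order is, up to reflection, \<open>T (D\<^sup>k \<phi>)\<close> with an operator \<open>T\<close> that
  commutes with differentiation and is bounded, on bounded sets of arguments, by the supremum norm as
  long as the supports stay in a fixed interval. The supports of \<open>\<phi>\<^sub>\<epsilon>\<close> do so for \<open>\<epsilon> < 1\<close>, and the only loss is
  the factor \<open>\<epsilon>\<close> to the power \<open>-(p + k + 1)\<close> from the scaling of \<open>D\<^sup>p D\<^sup>k \<phi>\<^sub>\<epsilon>\<close>.
\<close>

lemma translation_invariant_moderate:
  fixes T :: "(real \<Rightarrow> complex) \<Rightarrow> real \<Rightarrow> complex"
  assumes deriv: "\<And>\<Theta> x. \<Theta> \<in> test_functions \<Longrightarrow> (T \<Theta> has_vector_derivative T (nderiv 1 \<Theta>) x) (at x)"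
    and bound: "\<And>R M. \<exists>C. \<forall>\<Theta>\<in>test_functions. \<forall>B. (\<forall>x. \<bar>x\<bar> > R \<longrightarrow> \<Theta> x = 0) \<longrightarrow>
      (\<forall>x. norm (\<Theta> x) \<le> B) \<longrightarrow> (\<forall>t. \<bar>t\<bar> \<le> M \<longrightarrow> norm (T \<Theta> t) \<le> C * B)"
  shows "(\<lambda>\<phi>\<in>test_moments 0. \<lambda>x. T (nderiv k \<phi>) (- x)) \<in> moderate"
proof -
  define D where "D = (\<lambda>\<phi> p x. (-1) ^ p * T (nderiv (p + k) \<phi>) (- x))"
  have D: "(D \<phi> p has_vector_derivative D \<phi> (Suc p) x) (at x)" if "\<phi> \<in> test_moments q" for \<phi> p x q
  proof -
    have "(uminus has_vector_derivative -1) (at x)"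
      by (auto intro!: derivative_eq_intros)
    moreover have "(T (nderiv (p + k) \<phi>) has_vector_derivative T (nderiv (Suc p + k) \<phi>) (- x)) (at (- x))"
      using deriv[OF test_functions_nderiv, of \<phi> "p + k" "- x"] that
      by (simp add: test_moments_def nderiv_nderiv)
    ultimately have "((\<lambda>x. T (nderiv (p + k) \<phi>) (- x)) has_vector_derivative
        (-1) *\<^sub>R T (nderiv (Suc p + k) \<phi>) (- x)) (at x)"
      using vector_diff_chain_at[of uminus "-1" x "T (nderiv (p + k) \<phi>)"] by (simp add: o_def)
    from has_vector_derivative_mult_right[OF this, of "(-1) ^ p"] show ?thesis
      by (simp add: D_def)
  qed
  have D0: "D \<phi> 0 = (\<lambda>x. T (nderiv k \<phi>) (- x))" for \<phi>
    by (simp add: D_def)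
  show ?thesis
    unfolding moderate_iff
  proof (intro conjI allI impI)
    show "(\<lambda>\<phi>\<in>test_moments 0. \<lambda>x. T (nderiv k \<phi>) (- x)) \<in> E_alg"
      using smoothI[of "D \<phi>" for \<phi>, OF D] by (auto simp: E_alg_def D0)
    fix K p assume "compact (K :: real set)"
    then obtain M where M: "\<And>x. x \<in> K \<Longrightarrow> \<bar>x\<bar> \<le> M"
      using compact_imp_bounded[of K] by (auto simp: bounded_real)
    define q where "q = Suc (p + k)"
    have "growth_bound (\<lambda>\<phi>\<in>test_moments 0. \<lambda>x. T (nderiv k \<phi>) (- x)) \<phi> K p (- real q)"
      if \<phi>: "\<phi> \<in> test_moments q" for \<phi>
    proof -
      have \<phi>t: "\<phi> \<in> test_functions"
        using \<phi> by (rule test_moments_test_functions)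
      obtain R where R: "R > 0" "\<And>x. \<bar>x\<bar> > R \<Longrightarrow> \<phi> x = 0"
        using \<phi>t by (auto simp: test_functions_iff)
      obtain B where B: "B > 0" "\<And>x. norm (nderiv (p + k) \<phi> x) \<le> B"
        using test_functions_bounded[OF test_functions_nderiv[OF \<phi>t]] by metis
      obtain C where C: "\<forall>\<Theta>\<in>test_functions. \<forall>B. (\<forall>x. \<bar>x\<bar> > R \<longrightarrow> \<Theta> x = 0) \<longrightarrow>
          (\<forall>x. norm (\<Theta> x) \<le> B) \<longrightarrow> (\<forall>t. \<bar>t\<bar> \<le> M \<longrightarrow> norm (T \<Theta> t) \<le> C * B)"
        using bound[of R M] by (elim exE)
      have small: "\<forall>\<^sub>F \<epsilon> in at_right 0. \<epsilon> \<in> {0<..<1::real}"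
        by (rule eventually_at_right_real) simp
      have "\<forall>\<^sub>F \<epsilon> in at_right 0. \<forall>x\<in>K.
          norm (nderiv p ((\<lambda>\<phi>\<in>test_moments 0. \<lambda>x. T (nderiv k \<phi>) (- x)) (rescale \<epsilon> \<phi>)) x)
          \<le> (C * B) * \<epsilon> powr (- real q)"
        using small
      proof eventually_elim
        case (elim \<epsilon>)
        show ?case
        proof
          fix x assume x: "x \<in> K"
          have resc: "rescale \<epsilon> \<phi> \<in> test_moments 0"
            using \<phi> elim by (intro rescale_test_moments_0) auto
          define \<Theta> where "\<Theta> = nderiv (p + k) (rescale \<epsilon> \<phi>)"
          have \<Theta>: "\<Theta> y = of_real (inverse \<epsilon> ^ q) * nderiv (p + k) \<phi> (inverse \<epsilon> * y)" for y
            unfolding \<Theta>_def q_def nderiv_rescale[OF test_functions_smooth[OF \<phi>t]] ..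
          have "\<Theta> \<in> test_functions"
            unfolding \<Theta>_def by (intro test_functions_nderiv test_moments_test_functions[OF resc])
          moreover have "\<forall>y. \<bar>y\<bar> > R \<longrightarrow> \<Theta> y = 0"
          proof (intro allI impI)
            fix y assume "\<bar>y\<bar> > R"
            moreover have "\<bar>y\<bar> \<le> \<bar>inverse \<epsilon> * y\<bar>"
              using elim mult_right_mono[of 1 "inverse \<epsilon>" "\<bar>y\<bar>"]
              by (simp add: abs_mult one_le_inverse_iff)
            ultimately show "\<Theta> y = 0"
              unfolding \<Theta> using nderiv_eq_0_outside[OF R(2)] by simp
          qed
          moreover have "\<forall>y. norm (\<Theta> y) \<le> \<epsilon> powr (- real q) * B"
          proof
            fix y
            have "norm (\<Theta> y) = inverse \<epsilon> ^ q * norm (nderiv (p + k) \<phi> (inverse \<epsilon> * y))"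
              unfolding \<Theta> norm_mult norm_of_real using elim by simp
            also have "\<dots> \<le> inverse \<epsilon> ^ q * B"
              using elim by (intro mult_left_mono B) auto
            also have "inverse \<epsilon> ^ q = \<epsilon> powr (- real q)"
              using elim by (simp add: powr_minus powr_realpow power_inverse)
            finally show "norm (\<Theta> y) \<le> \<epsilon> powr (- real q) * B" .
          qed
          moreover have "\<bar>- x\<bar> \<le> M"
            using M[OF x] by simp
          ultimately have "norm (T \<Theta> (- x)) \<le> C * (\<epsilon> powr (- real q) * B)"
            using C by blast
          moreover have "nderiv p ((\<lambda>\<phi>\<in>test_moments 0. \<lambda>x. T (nderiv k \<phi>) (- x)) (rescale \<epsilon> \<phi>)) x =
              D (rescale \<epsilon> \<phi>) p x"
            using resc nderiv_eqI[of "D (rescale \<epsilon> \<phi>)", OF D[OF resc], of p] by (simp add: D0)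
          ultimately show "norm (nderiv p ((\<lambda>\<phi>\<in>test_moments 0. \<lambda>x. T (nderiv k \<phi>) (- x)) (rescale \<epsilon> \<phi>)) x)
              \<le> (C * B) * \<epsilon> powr (- real q)"
            by (simp add: D_def norm_mult norm_power \<Theta>_def mult_ac)
        qed
      qed
      then show ?thesis unfolding growth_bound_def by blast
    qed
    then show "\<exists>q\<ge>1. \<forall>\<phi>\<in>test_moments q.
        growth_bound (\<lambda>\<phi>\<in>test_moments 0. \<lambda>x. T (nderiv k \<phi>) (- x)) \<phi> K p (- real q)"
      by (intro exI[of _ q]) (simp add: q_def)
  qed
qed

lemma frac_right_test_norm_le:
  assumes "a > -1" "\<Theta> \<in> test_functions" "\<And>x. \<bar>x\<bar> > R \<Longrightarrow> \<Theta> x = 0" "\<And>x. norm (\<Theta> x) \<le> B" "\<bar>t\<bar> \<le> M"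
  shows "norm (frac_right a \<Theta> t) \<le> (LINT y:{..R + M}|lborel. power_kernel a y) * B"
proof -
  have "norm (frac_right a \<Theta> t) \<le> B * (LINT y:{..R + M}|lborel. power_kernel a y)"
  proof (rule frac_right_norm_le[where R = R])
    show "B \<ge> 0" using assms(4)[of 0] norm_ge_zero order_trans by blast
  qed (use assms in \<open>auto intro: test_functions_right_supp\<close>)
  then show ?thesis by (simp add: mult.commute)
qed

lemma nu_plus_moderate: "(\<lambda>\<phi>\<in>test_moments 0. convolve (nu_plus a) (reflect \<phi>)) \<in> moderate"
proof -
  define r where "r = nu_shift a"
  have a: "a + real r > -1"
    unfolding r_def by (rule nu_shift)
  have "(\<lambda>\<phi>\<in>test_moments 0. \<lambda>x. (-1) ^ r * frac_right (a + real r) (nderiv r \<phi>) (- x)) \<in> moderate"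
  proof (rule translation_invariant_moderate)
    show "((\<lambda>x. (-1) ^ r * frac_right (a + real r) \<Theta> x) has_vector_derivative
        (-1) ^ r * frac_right (a + real r) (nderiv 1 \<Theta>) x) (at x)" if "\<Theta> \<in> test_functions" for \<Theta> x
      by (intro has_vector_derivative_mult_right frac_right_test_has_derivative a that)
    show "\<exists>C. \<forall>\<Theta>\<in>test_functions. \<forall>B. (\<forall>x. \<bar>x\<bar> > R \<longrightarrow> \<Theta> x = 0) \<longrightarrow> (\<forall>x. norm (\<Theta> x) \<le> B) \<longrightarrow>
        (\<forall>t. \<bar>t\<bar> \<le> M \<longrightarrow> norm ((-1) ^ r * frac_right (a + real r) \<Theta> t) \<le> C * B)" for R M
      unfolding norm_mult norm_power norm_minus_cancel norm_one power_one mult_1_left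
      using frac_right_test_norm_le[OF a] by blast
  qed
  also have "(\<lambda>\<phi>\<in>test_moments 0. \<lambda>x. (-1) ^ r * frac_right (a + real r) (nderiv r \<phi>) (- x)) =
      (\<lambda>\<phi>\<in>test_moments 0. convolve (nu_plus a) (reflect \<phi>))"
    unfolding r_def by (intro restrict_ext ext convolve_nu_plus[symmetric] test_functions_smooth
        test_moments_test_functions)
  finally show ?thesis .
qed

lemma nu_minus_moderate: "(\<lambda>\<phi>\<in>test_moments 0. convolve (nu_minus b) (reflect \<phi>)) \<in> moderate"
proof -
  define s where "s = nu_shift b"
  have b: "b + real s > -1"
    unfolding s_def by (rule nu_shift)
  have "(\<lambda>\<phi>\<in>test_moments 0. \<lambda>x. frac_left (b + real s) (nderiv s \<phi>) (- x)) \<in> moderate"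
  proof (rule translation_invariant_moderate)
    show "(frac_left (b + real s) \<Theta> has_vector_derivative
        frac_left (b + real s) (nderiv 1 \<Theta>) x) (at x)" if "\<Theta> \<in> test_functions" for \<Theta> x
      by (intro frac_left_test_has_derivative b that)
    show "\<exists>C. \<forall>\<Theta>\<in>test_functions. \<forall>B. (\<forall>x. \<bar>x\<bar> > R \<longrightarrow> \<Theta> x = 0) \<longrightarrow> (\<forall>x. norm (\<Theta> x) \<le> B) \<longrightarrow>
        (\<forall>t. \<bar>t\<bar> \<le> M \<longrightarrow> norm (frac_left (b + real s) \<Theta> t) \<le> C * B)" for R M
    proof (intro exI ballI allI impI)
      fix \<Theta> B t
      assume "\<Theta> \<in> test_functions" "\<forall>x. \<bar>x\<bar> > R \<longrightarrow> \<Theta> x = 0" "\<forall>x. norm (\<Theta> x) \<le> B" "\<bar>t\<bar> \<le> M"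
      then show "norm (frac_left (b + real s) \<Theta> t) \<le> (LINT y:{..R + M}|lborel. power_kernel (b + real s) y) * B"
        unfolding frac_left_reflect
        by (intro frac_right_test_norm_le b test_functions_reflect) auto
    qed
  qed
  also have "(\<lambda>\<phi>\<in>test_moments 0. \<lambda>x. frac_left (b + real s) (nderiv s \<phi>) (- x)) =
      (\<lambda>\<phi>\<in>test_moments 0. convolve (nu_minus b) (reflect \<phi>))"
    unfolding s_def by (intro restrict_ext ext convolve_nu_minus[symmetric] test_functions_smooth
        test_moments_test_functions)
  finally show ?thesis .
qed

lemma dirac_moderate: "(\<lambda>\<phi>\<in>test_moments 0. convolve dirac (reflect \<phi>)) \<in> moderate"
proof -
  have "(\<lambda>\<phi>\<in>test_moments 0. \<lambda>x. nderiv 0 \<phi> (- x)) \<in> moderate"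
  proof (rule translation_invariant_moderate[where T = "\<lambda>\<Theta>. \<Theta>"])
    show "(\<Theta> has_vector_derivative nderiv 1 \<Theta> x) (at x)" if "\<Theta> \<in> test_functions" for \<Theta> x
      using test_functions_has_derivative[OF that, of 0 x] by simp
  qed (auto intro!: exI[of _ 1])
  also have "(\<lambda>\<phi>\<in>test_moments 0. \<lambda>x. nderiv 0 \<phi> (- x)) =
      (\<lambda>\<phi>\<in>test_moments 0. convolve dirac (reflect \<phi>))"
    by (intro restrict_ext ext) (simp add: convolve_dirac)
  finally show ?thesis .
qed

lemma scaled_dirac_deriv_distribution: "dist_scale c (dist_deriv dirac) \<in> distributions"
proof -
  have u: "dist_scale c (dist_deriv dirac) \<psi> = - (c * nderiv 1 \<psi> 0)" for \<psi>
    by (simp add: dist_scale_def dist_deriv_def dirac_def)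
  have "norm (- (c * nderiv 1 \<psi> 0)) \<le> norm c * (\<Sum>k\<le>1. SUP x. norm (nderiv k \<psi> x))"
    if \<psi>: "\<psi> \<in> test_functions" for \<psi>
  proof -
    have bdd: "bdd_above (range (\<lambda>x. norm (nderiv k \<psi> x)))" for k
    proof -
      obtain B where "\<And>x. norm (nderiv k \<psi> x) \<le> B"
        using test_functions_bounded[OF test_functions_nderiv[OF \<psi>]] by metis
      then show ?thesis by (auto intro!: bdd_aboveI)
    qed
    have upper: "norm (nderiv k \<psi> 0) \<le> (SUP x. norm (nderiv k \<psi> x))" for k
      by (rule cSUP_upper[OF UNIV_I bdd])
    have "norm (nderiv 1 \<psi> 0) \<le> (\<Sum>k\<le>1. SUP x. norm (nderiv k \<psi> x))"
      using upper[of 1] order_trans[OF norm_ge_zero upper[of 0]] by simp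
    then show ?thesis
      by (simp add: norm_mult mult_left_mono del: sum.atMost_Suc)
  qed
  then show ?thesis
    unfolding distributions_def mem_Collect_eq u
    by (auto simp: nderiv_add nderiv_cmult test_functions_smooth algebra_simps
        simp del: sum.atMost_Suc)
qed

section \<open>The product\<close>

theorem theorem2:
  fixes a :: real
  assumes "a \<notin> \<int>"
  shows "(colombeau_embed (nu_plus a) \<otimes>\<^bsub>Colombeau\<^esub> colombeau_embed (nu_minus (- a - 2)))
           \<ominus>\<^bsub>Colombeau\<^esub> (colombeau_embed dirac \<otimes>\<^bsub>Colombeau\<^esub> colombeau_embed dirac)
         \<approx> dist_scale (of_real (- ((a + 1) / 2))) (dist_deriv dirac)"
proof -
  define r where "r = nu_shift a"
  define s where "s = nu_shift (- a - 2)"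
  define \<alpha> where "\<alpha> = a + real r"
  define \<beta> where "\<beta> = - a - 2 + real s"
  have ab: "\<alpha> > -1" "\<beta> > -1" "\<alpha> + \<beta> + 2 = real (r + s)"
    using nu_shift[of a] nu_shift[of "- a - 2"] by (simp_all add: \<alpha>_def \<beta>_def r_def s_def)
  define f where "f = (\<lambda>\<phi>\<in>test_moments 0. convolve (nu_plus a) (reflect \<phi>))"
  define g where "g = (\<lambda>\<phi>\<in>test_moments 0. convolve (nu_minus (- a - 2)) (reflect \<phi>))"
  define h where "h = (\<lambda>\<phi>\<in>test_moments 0. convolve dirac (reflect \<phi>))"
  define z where "z = (\<lambda>\<phi>\<in>test_moments 0. \<lambda>x. f \<phi> x * g \<phi> x - h \<phi> x * h \<phi> x)"
  note moderate = nu_plus_moderate[of a, folded f_def] nu_minus_moderate[of "- a - 2", folded g_def]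
    dirac_moderate[folded h_def]
  have z: "z \<phi> x = product_profile r s \<alpha> \<beta> \<phi> (- x)" if "\<phi> \<in> test_moments 0" for \<phi> x
  proof -
    have "smooth \<phi>"
      using that by (intro test_functions_smooth test_moments_test_functions)
    then show ?thesis
      using that by (simp add: z_def f_def g_def h_def product_profile_def convolve_nu_plus
          convolve_nu_minus convolve_dirac \<alpha>_def \<beta>_def r_def s_def)
  qed
  have lim: "((\<lambda>\<epsilon>. LINT x|lborel. z (rescale \<epsilon> \<phi>) x * \<psi> x) \<longlongrightarrow>
      dist_scale (of_real (- ((a + 1) / 2))) (dist_deriv dirac) \<psi>) (at_right 0)"
    if \<psi>: "\<psi> \<in> test_functions" and \<phi>: "\<phi> \<in> test_moments 0" for \<phi> \<psi>
  proof -
    define Q where "Q = product_profile r s \<alpha> \<beta> \<phi>"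
    have \<phi>t: "\<phi> \<in> test_functions"
      using \<phi> by (rule test_moments_test_functions)
    have int: "(LINT x|lborel. \<phi> x) = 1"
      using \<phi> by (auto simp: test_moments_def)
    obtain R where R: "\<And>t. \<bar>t\<bar> > R \<Longrightarrow> Q t = 0"
      using product_profile_compact_support(2)[OF ab \<phi>t] by (auto simp: Q_def)
    have "((\<lambda>\<epsilon>. LINT x|lborel. of_real ((inverse \<epsilon>)\<^sup>2) * Q (inverse \<epsilon> * (- x)) * \<psi> x) \<longlongrightarrow>
        - nderiv 1 \<psi> 0 * (LINT t|lborel. of_real t * Q t)) (at_right 0)"
      by (rule vanishing_integral_concentrates_to_dirac_deriv[OF _ R _ \<psi>])
         (simp_all add: Q_def product_profile_compact_support(1)[OF ab \<phi>t]
           integral_product_profile[OF ab \<phi>t])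
    also have "- nderiv 1 \<psi> 0 * (LINT t|lborel. of_real t * Q t) =
        dist_scale (of_real (- ((a + 1) / 2))) (dist_deriv dirac) \<psi>"
      unfolding Q_def first_moment_product_profile[OF ab \<phi>t] int
      by (simp add: \<alpha>_def dist_scale_def dist_deriv_def dirac_def)
    finally show ?thesis
    proof (rule Lim_transform_eventually)
      show "\<forall>\<^sub>F \<epsilon> in at_right 0.
          (LINT x|lborel. of_real ((inverse \<epsilon>)\<^sup>2) * Q (inverse \<epsilon> * (- x)) * \<psi> x) =
          (LINT x|lborel. z (rescale \<epsilon> \<phi>) x * \<psi> x)"
        using eventually_at_right_less
      proof eventually_elim
        case (elim \<epsilon>)
        show ?case
          unfolding z[OF rescale_test_moments[OF \<phi> elim]] Q_def
            product_profile_rescale[OF elim test_functions_smooth[OF \<phi>t] ab(3)] ..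
      qed
    qed
  qed
  show ?thesis
    unfolding admits_assoc_dist_def colombeau_embed_def f_def[symmetric] g_def[symmetric] h_def[symmetric]
  proof (intro conjI bexI ballI exI)
    show "dist_scale (of_real (- ((a + 1) / 2))) (dist_deriv dirac) \<in> distributions"
      by (rule scaled_dirac_deriv_distribution)
    show "z \<in> ((negligible_reps +>\<^bsub>EM\<^esub> f) \<otimes>\<^bsub>Colombeau\<^esub> (negligible_reps +>\<^bsub>EM\<^esub> g)) \<ominus>\<^bsub>Colombeau\<^esub>
        ((negligible_reps +>\<^bsub>EM\<^esub> h) \<otimes>\<^bsub>Colombeau\<^esub> (negligible_reps +>\<^bsub>EM\<^esub> h))"
      unfolding z_def by (intro Colombeau_mult_diff_cosets(2) moderate)
  qed (use lim in \<open>auto intro!: Colombeau_mult_diff_cosets(1) moderate\<close>)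
qed

end
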